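(* Let $(\overline{M},h)$ be a compact surface with interior $M$ and boundary $\partial M$ such that $K_h=0$ on $\overline{M}$. For $i=1,2$, let $u_i$ be the unique solution of the initial-boundary value problem $$u_t=e^{-2u}\Delta_h u-1\ \text{ in }\overline{M}\times[0,T),\qquad \frac{\partial u}{\partial n_h}+k_h=\psi_i e^{u}\ \text{ on }\partial M\times[0,T),\qquad u|_{t=0}=u_{0i}\ \text{ in }\overline{M},$$ where $u_{01}\le u_{02}$ on $\overline{M}$ and $\psi_1\le\psi_2$ on $\partial M\times[0,T)$. Then $u_1\le u_2$ on $\overline{M}\times[0,T)$.
   Context: $(\overline{M},h)$ is a smooth compact Riemannian surface with boundary; $K_h$ is its Gauss curvature, $n_h$ the outward unit normal along $\partial M$, $k_h$ the geodesic curvature of $\partial M$. $\alpha\in(0,1)$ is fixed. Solutions are classical: $u_i\in C^{2+\alpha,1+\frac{\alpha}{2}}(\overline{M}\times[0,t_1])$ (parabolic Hölder space) for every $t_1\in(0,T)$, with data $u_{0i}\in C^{2+\alpha}(\overline{M})$ and $\psi_i\in C^{1+\alpha,\frac12+\frac{\alpha}{2}}(\partial M\times[0,t_1])$ for every $t_1\in(0,T)$. Here $0<T\le\infty$. *)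

theory Defs
  imports "HOL-Analysis.Analysis"
begin

section \<open>Calculus up to the boundary on relatively open subsets of the closed half-plane\<close>

definition half_plane :: "(real^2) set" where
  "half_plane = {p. 0 \<le> p $ 2}"

text \<open>
  All derivatives are taken within a set \<open>V\<close>, which is always relatively open in the half-plane.
  There the derivative within \<open>V\<close> is unique: it is the usual one at points with
  \<open>p $ 2 > 0\<close> and the one-sided one at points with \<open>p $ 2 = 0\<close>.
\<close>

definition pd :: "(real^2) set \<Rightarrow> 2 \<Rightarrow> (real^2 \<Rightarrow> real) \<Rightarrow> real^2 \<Rightarrow> real" where
  "pd V i f p = frechet_derivative f (at p within V) (axis i 1)"

primrec Ck_on :: "nat \<Rightarrow> (real^2) set \<Rightarrow> (real^2 \<Rightarrow> real) \<Rightarrow> bool" where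
  "Ck_on 0 V f \<longleftrightarrow> continuous_on V f"
| "Ck_on (Suc k) V f \<longleftrightarrow> f differentiable_on V \<and> (\<forall>i. Ck_on k V (pd V i f))"

definition smooth_on :: "(real^2) set \<Rightarrow> (real^2 \<Rightarrow> real) \<Rightarrow> bool" where
  "smooth_on V f \<longleftrightarrow> (\<forall>k. Ck_on k V f)"


section \<open>Compact Riemannian surfaces with boundary\<close>

text \<open>
  A chart is a pair of a domain and a coordinate map into the closed half-plane. The boundary
  may be empty, and the surface need be neither connected nor orientable.
\<close>

type_synonym 'a chart = "'a set \<times> ('a \<Rightarrow> real^2)"

definition cimg :: "'a chart \<Rightarrow> (real^2) set" where
  "cimg c = snd c ` fst c"

definition cinv :: "'a chart \<Rightarrow> real^2 \<Rightarrow> 'a" where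
  "cinv c = inv_into (fst c) (snd c)"

definition is_chart :: "'a topology \<Rightarrow> 'a chart \<Rightarrow> bool" where
  "is_chart X c \<longleftrightarrow>
     openin X (fst c) \<and>
     openin (top_of_set half_plane) (cimg c) \<and>
     homeomorphic_map (subtopology X (fst c)) (top_of_set (cimg c)) (snd c)"

definition overlap :: "'a chart \<Rightarrow> 'a chart \<Rightarrow> (real^2) set" where
  "overlap c d = snd c ` (fst c \<inter> fst d)"

definition transition :: "'a chart \<Rightarrow> 'a chart \<Rightarrow> real^2 \<Rightarrow> real^2" where
  "transition c d = snd d \<circ> cinv c"

definition smooth_atlas :: "'a topology \<Rightarrow> 'a chart set \<Rightarrow> bool" where
  "smooth_atlas X A \<longleftrightarrow>
     (\<forall>c\<in>A. is_chart X c) \<and>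
     (\<Union>c\<in>A. fst c) = topspace X \<and>
     (\<forall>c\<in>A. \<forall>d\<in>A. \<forall>i. smooth_on (overlap c d) (\<lambda>p. transition c d p $ i))"

definition boundary :: "'a chart set \<Rightarrow> 'a set" where
  "boundary A = {x. \<exists>c\<in>A. x \<in> fst c \<and> snd c x $ 2 = 0}"

definition jacobian :: "'a chart \<Rightarrow> 'a chart \<Rightarrow> real^2 \<Rightarrow> real^2^2" where
  "jacobian c d p = (\<chi> k i. pd (overlap c d) i (\<lambda>q. transition c d q $ k) p)"

text \<open>
  A Riemannian metric is given by its coefficient matrices \<open>g c p\<close> in each chart \<open>c\<close>, subject to
  the transformation law of a covariant 2-tensor.
\<close>

definition riemannian_metric :: "'a chart set \<Rightarrow> ('a chart \<Rightarrow> real^2 \<Rightarrow> real^2^2) \<Rightarrow> bool" where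
  "riemannian_metric A g \<longleftrightarrow>
     (\<forall>c\<in>A. \<forall>i j. smooth_on (cimg c) (\<lambda>p. g c p $ i $ j)) \<and>
     (\<forall>c\<in>A. \<forall>p\<in>cimg c. transpose (g c p) = g c p \<and> (\<forall>v. v \<noteq> 0 \<longrightarrow> 0 < v \<bullet> (g c p *v v))) \<and>
     (\<forall>c\<in>A. \<forall>d\<in>A. \<forall>p\<in>overlap c d.
        g c p = transpose (jacobian c d p) ** g d (transition c d p) ** jacobian c d p)"

definition compact_riemannian_surface ::
    "'a topology \<Rightarrow> 'a chart set \<Rightarrow> ('a chart \<Rightarrow> real^2 \<Rightarrow> real^2^2) \<Rightarrow> bool" where
  "compact_riemannian_surface X A g \<longleftrightarrow>
     compact_space X \<and> Hausdorff_space X \<and> smooth_atlas X A \<and> riemannian_metric A g"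


section \<open>Geometric quantities in local coordinates\<close>

text \<open>
  Here \<open>V\<close> is the image of a chart and \<open>G\<close> the coefficient matrix of the metric in that chart.
  The values are independent of the chart.
\<close>

definition christoffel :: "(real^2) set \<Rightarrow> (real^2 \<Rightarrow> real^2^2) \<Rightarrow> 2 \<Rightarrow> 2 \<Rightarrow> 2 \<Rightarrow> real^2 \<Rightarrow> real" where
  "christoffel V G k i j p =
     (\<Sum>l\<in>UNIV. matrix_inv (G p) $ k $ l *
        (pd V i (\<lambda>q. G q $ j $ l) p + pd V j (\<lambda>q. G q $ i $ l) p - pd V l (\<lambda>q. G q $ i $ j) p)) / 2"

text \<open>
  \<open>riemann V G l i j k\<close> is the component along the \<open>l\<close>-th coordinate field of
  \<open>R(e_i, e_j) e_k = \<nabla>_i \<nabla>_j e_k - \<nabla>_j \<nabla>_i e_k\<close>. With this sign the unit sphere has curvature 1.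
\<close>

definition riemann :: "(real^2) set \<Rightarrow> (real^2 \<Rightarrow> real^2^2) \<Rightarrow> 2 \<Rightarrow> 2 \<Rightarrow> 2 \<Rightarrow> 2 \<Rightarrow> real^2 \<Rightarrow> real" where
  "riemann V G l i j k p =
     pd V i (christoffel V G l j k) p - pd V j (christoffel V G l i k) p +
     (\<Sum>m\<in>UNIV. christoffel V G m j k p * christoffel V G l i m p
               - christoffel V G m i k p * christoffel V G l j m p)"

definition gauss_curvature :: "(real^2) set \<Rightarrow> (real^2 \<Rightarrow> real^2^2) \<Rightarrow> real^2 \<Rightarrow> real" where
  "gauss_curvature V G p = (\<Sum>l\<in>UNIV. G p $ 1 $ l * riemann V G l 1 2 2 p) / det (G p)"

text \<open>The Laplace-Beltrami operator, as the trace of the covariant Hessian.\<close>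

definition laplacian ::
    "(real^2) set \<Rightarrow> (real^2 \<Rightarrow> real^2^2) \<Rightarrow> (real^2 \<Rightarrow> real) \<Rightarrow> real^2 \<Rightarrow> real" where
  "laplacian V G f p =
     (\<Sum>i\<in>UNIV. \<Sum>j\<in>UNIV. matrix_inv (G p) $ i $ j *
        (pd V i (pd V j f) p - (\<Sum>k\<in>UNIV. christoffel V G k i j p * pd V k f p)))"

text \<open>
  At a boundary point the tangent line of the boundary is spanned by the first coordinate vector,
  and the outward vectors are those with negative second coordinate.
\<close>

definition outward_normal :: "(real^2 \<Rightarrow> real^2^2) \<Rightarrow> real^2 \<Rightarrow> real^2" where
  "outward_normal G p =
     (THE \<nu>. axis 1 1 \<bullet> (G p *v \<nu>) = 0 \<and> \<nu> \<bullet> (G p *v \<nu>) = 1 \<and> \<nu> $ 2 < 0)"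

definition normal_deriv ::
    "(real^2) set \<Rightarrow> (real^2 \<Rightarrow> real^2^2) \<Rightarrow> (real^2 \<Rightarrow> real) \<Rightarrow> real^2 \<Rightarrow> real" where
  "normal_deriv V G f p = (\<Sum>i\<in>UNIV. outward_normal G p $ i * pd V i f p)"

text \<open>
  The geodesic curvature is \<open>- \<langle>\<nabla>_\<tau> \<tau>, n\<rangle>\<close> with \<open>\<tau> = e_1 / \<bar>e_1\<bar>\<close> the unit tangent and \<open>n\<close> the
  outward unit normal, so that it equals 1 for the flat unit disc. Differentiating the
  factor \<open>1 / \<bar>e_1\<bar>\<close> only gives a tangential term, whence
  \<open>- \<langle>\<nabla>_1 e_1, n\<rangle> / \<bar>e_1\<bar>^2\<close>.
\<close>

definition geodesic_curvature :: "(real^2) set \<Rightarrow> (real^2 \<Rightarrow> real^2^2) \<Rightarrow> real^2 \<Rightarrow> real" where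
  "geodesic_curvature V G p =
     - ((\<chi> k. christoffel V G k 1 1 p) \<bullet> (G p *v outward_normal G p)) / (G p $ 1 $ 1)"


section \<open>Hoelder spaces\<close>

text \<open>
  On a compact surface, membership in a Hoelder space means finite Hoelder seminorms in each chart
  on each compact subset of its image.
\<close>

definition holder_on :: "real \<Rightarrow> real \<Rightarrow> 'b::metric_space set \<Rightarrow> ('b \<Rightarrow> real) \<Rightarrow> bool" where
  "holder_on a C S f \<longleftrightarrow> (\<forall>p\<in>S. \<forall>q\<in>S. \<bar>f p - f q\<bar> \<le> C * dist p q powr a)"

definition parabolic_holder_on ::
    "real \<Rightarrow> 'b::metric_space set \<Rightarrow> real set \<Rightarrow> ('b \<Rightarrow> real \<Rightarrow> real) \<Rightarrow> bool" where
  "parabolic_holder_on a K I f \<longleftrightarrow>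
     (\<exists>C. \<forall>t\<in>I. holder_on a C K (\<lambda>p. f p t)) \<and> (\<exists>C. \<forall>p\<in>K. holder_on (a / 2) C I (f p))"

definition time_holder_on ::
    "real \<Rightarrow> 'b set \<Rightarrow> real set \<Rightarrow> ('b \<Rightarrow> real \<Rightarrow> real) \<Rightarrow> bool" where
  "time_holder_on b K I f \<longleftrightarrow> (\<exists>C. \<forall>p\<in>K. holder_on b C I (f p))"

text \<open>The space \<open>C^(2+\<alpha>)\<close> of the surface.\<close>

definition holder_C2 :: "'a chart set \<Rightarrow> real \<Rightarrow> ('a \<Rightarrow> real) \<Rightarrow> bool" where
  "holder_C2 A \<alpha> f \<longleftrightarrow>
     (\<forall>c\<in>A. let V = cimg c; v = f \<circ> cinv c in
        Ck_on 2 V v \<and>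
        (\<forall>K i j. compact K \<and> K \<subseteq> V \<longrightarrow> (\<exists>C. holder_on \<alpha> C K (pd V i (pd V j v)))))"

text \<open>The space \<open>C^(2+\<alpha>, 1+\<alpha>/2)\<close> of the surface times \<open>I\<close>.\<close>

definition holder_C2_1 :: "'a chart set \<Rightarrow> real \<Rightarrow> real set \<Rightarrow> ('a \<Rightarrow> real \<Rightarrow> real) \<Rightarrow> bool" where
  "holder_C2_1 A \<alpha> I u \<longleftrightarrow>
     (\<forall>c\<in>A.
        let V = cimg c;
            v = (\<lambda>p t. u (cinv c p) t);
            D = (\<lambda>i p t. pd V i (\<lambda>q. v q t) p);
            DD = (\<lambda>i j p t. pd V i (\<lambda>q. D j q t) p);
            Dt = (\<lambda>p t. vector_derivative (v p) (at t within I))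
        in
          (\<forall>t\<in>I. (\<lambda>q. v q t) differentiable_on V) \<and>
          (\<forall>t\<in>I. \<forall>j. (\<lambda>q. D j q t) differentiable_on V) \<and>
          (\<forall>p\<in>V. v p differentiable_on I) \<and>
          continuous_on (V \<times> I) (\<lambda>(p, t). v p t) \<and>
          (\<forall>i. continuous_on (V \<times> I) (\<lambda>(p, t). D i p t)) \<and>
          (\<forall>i j. continuous_on (V \<times> I) (\<lambda>(p, t). DD i j p t)) \<and>
          continuous_on (V \<times> I) (\<lambda>(p, t). Dt p t) \<and>
          (\<forall>K. compact K \<and> K \<subseteq> V \<longrightarrow>
             (\<forall>i j. parabolic_holder_on \<alpha> K I (DD i j)) \<and>
             parabolic_holder_on \<alpha> K I Dt \<and>
             (\<forall>i. time_holder_on ((1 + \<alpha>) / 2) K I (D i))))"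

text \<open>
  The space \<open>C^(1+\<alpha>, 1/2+\<alpha>/2)\<close> of the boundary times \<open>I\<close>; the boundary is parametrised by the
  first coordinate, whose range in a chart is an open set of reals.
\<close>

definition holder_boundary :: "'a chart set \<Rightarrow> real \<Rightarrow> real set \<Rightarrow> ('a \<Rightarrow> real \<Rightarrow> real) \<Rightarrow> bool" where
  "holder_boundary A \<alpha> I \<psi> \<longleftrightarrow>
     (\<forall>c\<in>A.
        let B = {s. vector [s, 0] \<in> cimg c};
            v = (\<lambda>s t. \<psi> (cinv c (vector [s, 0])) t);
            D = (\<lambda>s t. deriv (\<lambda>r. v r t) s)
        in
          (\<forall>t\<in>I. (\<lambda>s. v s t) differentiable_on B) \<and>
          continuous_on (B \<times> I) (\<lambda>(s, t). v s t) \<and>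
          continuous_on (B \<times> I) (\<lambda>(s, t). D s t) \<and>
          (\<forall>K. compact K \<and> K \<subseteq> B \<longrightarrow>
             parabolic_holder_on \<alpha> K I D \<and>
             time_holder_on ((1 + \<alpha>) / 2) K I v))"


section \<open>The initial-boundary value problem\<close>

definition time_span :: "ereal \<Rightarrow> real set" where
  "time_span T = {t. 0 \<le> t \<and> ereal t < T}"

definition admissible_data ::
    "'a chart set \<Rightarrow> real \<Rightarrow> ereal \<Rightarrow> ('a \<Rightarrow> real \<Rightarrow> real) \<Rightarrow> ('a \<Rightarrow> real) \<Rightarrow> bool" where
  "admissible_data A \<alpha> T \<psi> u0 \<longleftrightarrow>
     holder_C2 A \<alpha> u0 \<and>
     (\<forall>t1. 0 < t1 \<and> ereal t1 < T \<longrightarrow> holder_boundary A \<alpha> {0..t1} \<psi>)"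

text \<open>Classical solutions for a flat background metric; the time derivative is one-sided at 0.\<close>

definition classical_solution ::
    "'a topology \<Rightarrow> 'a chart set \<Rightarrow> ('a chart \<Rightarrow> real^2 \<Rightarrow> real^2^2) \<Rightarrow> real \<Rightarrow> ereal \<Rightarrow>
     ('a \<Rightarrow> real \<Rightarrow> real) \<Rightarrow> ('a \<Rightarrow> real) \<Rightarrow> ('a \<Rightarrow> real \<Rightarrow> real) \<Rightarrow> bool" where
  "classical_solution X A g \<alpha> T \<psi> u0 u \<longleftrightarrow>
     (\<forall>t1. 0 < t1 \<and> ereal t1 < T \<longrightarrow> holder_C2_1 A \<alpha> {0..t1} u) \<and>
     (\<forall>c\<in>A. \<forall>x\<in>fst c. \<forall>t\<in>time_span T.
        (u x has_real_derivative
           exp (- 2 * u x t) * laplacian (cimg c) (g c) (\<lambda>q. u (cinv c q) t) (snd c x) - 1)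
        (at t within time_span T)) \<and>
     (\<forall>c\<in>A. \<forall>x\<in>fst c. snd c x $ 2 = 0 \<longrightarrow> (\<forall>t\<in>time_span T.
        normal_deriv (cimg c) (g c) (\<lambda>q. u (cinv c q) t) (snd c x)
          + geodesic_curvature (cimg c) (g c) (snd c x) = \<psi> x t * exp (u x t))) \<and>
     (\<forall>x\<in>topspace X. u x 0 = u0 x)"

end

theory Submission imports Defs begin

text \<open>
  The difference \<open>w = u1 - u2\<close> satisfies a linear parabolic inequality with a Robin boundary
  inequality \<open>\<partial>w / \<partial>n \<le> C w\<close> where \<open>w > 0\<close>. As \<open>C\<close> may be positive, the maximum principle has to be applied
  to \<open>w / (e^(L t) E)\<close> with a weight \<open>E\<close> whose normal derivative exceeds \<open>C E\<close>. Such an \<open>E\<close> is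
  obtained as the minimum of finitely many functions, each a quadratic polynomial in a
  chart: at a maximum point only the polynomial attaining the minimum matters, so no change of charts
  is ever computed. In a chart the polynomial is larger on the rim of its ball than some other
  polynomial of the family, hence the maximum is attained inside the ball, and for large \<open>L\<close> it contradicts
  the equation in the interior or the boundary condition on the boundary. The zeroth order term
  \<open>(e^(-2 u1) - e^(-2 u2)) \<Delta> u2\<close> is controlled through \<open>e^(-2 u2) \<Delta> u2 = \<partial>_t u2 + 1\<close>.
\<close>

section \<open>Maxima on the half-plane\<close>

lemma at_within_half_plane_interior:
  assumes "openin (top_of_set half_plane) V" and "q \<in> V" and "0 < q $ 2"
  shows "at q within V = at q" and "q \<in> interior V"
proof -
  obtain U where U: "open U" "V = half_plane \<inter> U"
    using assms(1) by (auto simp: openin_open)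
  have "open (U \<inter> {p. 0 < p $ 2})"
    using U(1) by (intro open_Int open_Collect_less continuous_intros)
  moreover have "q \<in> U \<inter> {p. 0 < p $ 2}" "U \<inter> {p. 0 < p $ 2} \<subseteq> V"
    using assms U(2) by (auto simp: half_plane_def)
  ultimately show "q \<in> interior V"
    by (meson interiorI)
  then show "at q within V = at q"
    by (rule at_within_interior)
qed

text \<open>Only the ray from \<open>q\<close> in direction \<open>e\<close> enters: a positive
  derivative along it would make \<open>f\<close> increase at first. Being one-sided, the test
  applies at boundary points of the half-plane and, with \<open>e = - 1\<close>, at the last instant
  of a time interval.\<close>

lemma has_derivative_max_direction:
  fixes f :: "'v::real_normed_vector \<Rightarrow> real"
  assumes f: "(f has_derivative f') (at q within V)"
    and d: "0 < d" "\<And>t. 0 \<le> t \<Longrightarrow> t < d \<Longrightarrow> q + t *\<^sub>R e \<in> V \<and> f (q + t *\<^sub>R e) \<le> f q"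
  shows "f' e \<le> 0"
proof (rule ccontr)
  assume "\<not> f' e \<le> 0"
  interpret bounded_linear f' using f by (rule has_derivative_bounded_linear)
  have img: "(\<lambda>t. q + t *\<^sub>R e) ` {0..<d} \<subseteq> V"
    using d by auto
  have "((\<lambda>t. q + t *\<^sub>R e) has_derivative (\<lambda>t. t *\<^sub>R e)) (at 0 within {0..<d})"
    by (auto intro!: derivative_eq_intros)
  moreover have "(f has_derivative f') (at (q + 0 *\<^sub>R e) within (\<lambda>t. q + t *\<^sub>R e) ` {0..<d})"
    using has_derivative_subset[OF f img] by simp
  ultimately have "((\<lambda>t. f (q + t *\<^sub>R e)) has_derivative (\<lambda>t. f' (t *\<^sub>R e))) (at 0 within {0..<d})"
    using has_derivative_in_compose by blast
  then have "((\<lambda>t. f (q + t *\<^sub>R e)) has_real_derivative f' e) (at 0 within {0..<d})"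
    by (simp add: has_field_derivative_def scale mult_commute_abs)
  then obtain d' where d': "d' > 0" "\<And>h. h > 0 \<Longrightarrow> 0 + h \<in> {0..<d} \<Longrightarrow> h < d' \<Longrightarrow> f (q + 0 *\<^sub>R e) < f (q + (0 + h) *\<^sub>R e)"
    using has_real_derivative_pos_inc_right \<open>\<not> f' e \<le> 0\<close> by (metis not_le)
  define h where "h = min d d' / 2"
  have "h > 0" "h < d" "h < d'" using d(1) d'(1) by (auto simp: h_def)
  then show False using d'(2)[of h] d(2)[of h] by auto
qed

text \<open>Both directions along the boundary line stay in the half-plane, so the tangential
  derivative vanishes; transversally only the inward direction is available, which leaves one
  sign.\<close>

lemma boundary_maximum:
  fixes f :: "real^2 \<Rightarrow> real"
  assumes V: "openin (top_of_set half_plane) V" and q: "q \<in> V" "q $ 2 = 0"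
    and f: "(f has_derivative f') (at q within V)"
    and max: "eventually (\<lambda>y. y \<in> half_plane \<longrightarrow> f y \<le> f q) (nhds q)"
  shows "f' (axis 1 1) = 0" and "f' (axis 2 1) \<le> 0"
proof -
  obtain U where U: "open U" "V = half_plane \<inter> U"
    using V by (auto simp: openin_open)
  have "eventually (\<lambda>y. y \<in> U \<and> (y \<in> half_plane \<longrightarrow> f y \<le> f q)) (nhds q)"
    using max eventually_nhds_in_open[OF U(1)] q U(2) by (intro eventually_conj) auto
  then obtain d where d: "d > 0" "\<And>y. dist y q < d \<Longrightarrow> y \<in> U \<and> (y \<in> half_plane \<longrightarrow> f y \<le> f q)"
    unfolding eventually_nhds_metric by blast
  have le: "f' e \<le> 0" if "norm e = 1" "0 \<le> e $ 2" for e
  proof (rule has_derivative_max_direction[OF f d(1)])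
    fix t :: real assume t: "0 \<le> t" "t < d"
    have "q + t *\<^sub>R e \<in> half_plane" using that t q(2) by (simp add: half_plane_def)
    moreover have "dist (q + t *\<^sub>R e) q < d" using that t by (simp add: dist_norm)
    ultimately show "q + t *\<^sub>R e \<in> V \<and> f (q + t *\<^sub>R e) \<le> f q"
      using d(2) U(2) by blast
  qed
  interpret bounded_linear f' using f by (rule has_derivative_bounded_linear)
  have "f' (- axis 1 1) \<le> 0"
    by (rule le) (simp_all add: norm_axis_1, simp add: axis_def)
  moreover have "f' (axis 1 1) \<le> 0"
    by (rule le) (simp_all add: norm_axis_1, simp add: axis_def)
  ultimately show "f' (axis 1 1) = 0"
    by (simp add: neg)
  show "f' (axis 2 1) \<le> 0"
    by (rule le) (simp_all add: norm_axis_1)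
qed

text \<open>Second derivative test along the line through \<open>q\<close> in direction \<xi>.
  \<open>H\<close> is the derivative of the gradient at the single point \<open>q\<close>, with no
  symmetry assumed; the mean value theorem applied to the first derivative replaces a Taylor
  expansion.\<close>

lemma interior_maximum:
  fixes f :: "real^2 \<Rightarrow> real" and h :: "2 \<Rightarrow> real^2 \<Rightarrow> real" and H :: "2 \<Rightarrow> 2 \<Rightarrow> real"
  assumes f: "eventually (\<lambda>y. (f has_derivative (\<lambda>v. h 1 y * v $ 1 + h 2 y * v $ 2)) (at y)) (nhds q)"
    and h: "\<And>j. (h j has_derivative (\<lambda>v. H 1 j * v $ 1 + H 2 j * v $ 2)) (at q)"
    and max: "eventually (\<lambda>y. f y \<le> f q) (nhds q)"
  shows "h j q = 0" and "(\<Sum>i\<in>UNIV. \<Sum>j\<in>UNIV. H i j * \<xi> $ i * \<xi> $ j) \<le> 0"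
proof -
  obtain d where d: "d > 0" "\<And>y. dist y q < d \<Longrightarrow> f y \<le> f q \<and> (f has_derivative (\<lambda>v. h 1 y * v $ 1 + h 2 y * v $ 2)) (at y)"
    using eventually_conj[OF max f] unfolding eventually_nhds_metric by blast
  have le: "h 1 q * e $ 1 + h 2 q * e $ 2 \<le> 0" if "norm e = 1" for e :: "real^2"
  proof (rule has_derivative_max_direction[where f = f and q = q and V = UNIV and d = d and f' = "\<lambda>v. h 1 q * v $ 1 + h 2 q * v $ 2"])
    fix t :: real assume "0 \<le> t" "t < d"
    then have "dist (q + t *\<^sub>R e) q < d" using that by (simp add: dist_norm)
    then show "q + t *\<^sub>R e \<in> UNIV \<and> f (q + t *\<^sub>R e) \<le> f q" using d(2) by blast
  qed (use d in auto)
  have h0: "h j q = 0" for j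
    using le[of "axis 1 1"] le[of "- axis 1 1"] le[of "axis 2 1"] le[of "- axis 2 1"] exhaust_2[of j]
    by (auto simp: norm_axis_1) (auto simp: axis_def)
  then show "h j q = 0" .
  show "(\<Sum>i\<in>UNIV. \<Sum>j\<in>UNIV. H i j * \<xi> $ i * \<xi> $ j) \<le> 0"
  proof (rule ccontr)
    define l where "l = (\<Sum>i\<in>UNIV. \<Sum>j\<in>UNIV. H i j * \<xi> $ i * \<xi> $ j)"
    assume "\<not> (\<Sum>i\<in>UNIV. \<Sum>j\<in>UNIV. H i j * \<xi> $ i * \<xi> $ j) \<le> 0"
    then have "l > 0" by (simp add: l_def)
    define \<gamma> where "\<gamma> = (\<lambda>t::real. q + t *\<^sub>R \<xi>)"
    have \<gamma>: "(\<gamma> has_derivative (\<lambda>t. t *\<^sub>R \<xi>)) (at t)" for t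
      unfolding \<gamma>_def by (auto intro!: derivative_eq_intros)
    define \<phi>' where "\<phi>' = (\<lambda>t. h 1 (\<gamma> t) * \<xi> $ 1 + h 2 (\<gamma> t) * \<xi> $ 2)"
    have "((\<lambda>t. h j (\<gamma> t)) has_real_derivative (H 1 j * \<xi> $ 1 + H 2 j * \<xi> $ 2)) (at 0)" for j
    proof -
      have "(h j has_derivative (\<lambda>v. H 1 j * v $ 1 + H 2 j * v $ 2)) (at (\<gamma> 0))"
        using h[of j] by (simp add: \<gamma>_def)
      from has_derivative_compose[OF \<gamma> this] show ?thesis
        unfolding has_field_derivative_def
        by (rule has_derivative_eq_rhs) (auto simp: algebra_simps)
    qed
    then have "(\<phi>' has_real_derivative (H 1 1 * \<xi> $ 1 + H 2 1 * \<xi> $ 2) * \<xi> $ 1 + (H 1 2 * \<xi> $ 1 + H 2 2 * \<xi> $ 2) * \<xi> $ 2) (at 0)"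
      unfolding \<phi>'_def by (intro DERIV_add DERIV_cmult_right)
    also have "(H 1 1 * \<xi> $ 1 + H 2 1 * \<xi> $ 2) * \<xi> $ 1 + (H 1 2 * \<xi> $ 1 + H 2 2 * \<xi> $ 2) * \<xi> $ 2 = l"
      by (simp add: l_def sum_2 algebra_simps)
    finally obtain d' where d': "d' > 0" "\<And>t. t > 0 \<Longrightarrow> t < d' \<Longrightarrow> \<phi>' 0 < \<phi>' t"
      using has_real_derivative_pos_inc_right[of \<phi>' l 0 UNIV] \<open>l > 0\<close> by auto
    have "\<phi>' 0 = 0" by (simp add: \<phi>'_def \<gamma>_def h0)
    \<comment> \<open>The summand 1 keeps the quotient positive also for \<open>\<xi> = 0\<close>;
      halving the minimum makes both bounds on \<open>s\<close> strict.\<close>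
    define c where "c = d / (norm \<xi> + 1)"
    have "0 < c"
      using d(1) by (simp add: c_def add_nonneg_pos)
    define s where "s = min d' c / 2"
    have s: "0 < s" "s < d'" "s < d / (norm \<xi> + 1)"
      using d'(1) \<open>0 < c\<close> by (auto simp: s_def c_def[symmetric] min_def)
    have near: "dist (\<gamma> t) q < d" if "0 \<le> t" "t \<le> s" for t
    proof -
      have "t * norm \<xi> \<le> s * norm \<xi>" using that by (simp add: mult_right_mono)
      also have "\<dots> < s * (norm \<xi> + 1)" using s by simp
      also have "\<dots> < d" using s(3) by (simp only: pos_less_divide_eq add_nonneg_pos norm_ge_zero zero_less_one)
      finally show ?thesis using that by (simp add: \<gamma>_def dist_norm)
    qed
    have der: "((\<lambda>t. f (\<gamma> t)) has_real_derivative \<phi>' t) (at t)" if "0 \<le> t" "t \<le> s" for t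
      unfolding has_field_derivative_def
      by (rule has_derivative_eq_rhs[OF has_derivative_compose[OF \<gamma>]])
        (use d(2)[OF near[OF that]] in \<open>auto simp: \<phi>'_def algebra_simps\<close>)
    obtain z where z: "0 < z" "z < s" "f (\<gamma> s) - f (\<gamma> 0) = (s - 0) * \<phi>' z"
      using MVT2[OF s(1), of "\<lambda>t. f (\<gamma> t)" \<phi>'] der by blast
    have "\<phi>' z > 0" using d'(2)[of z] z s \<open>\<phi>' 0 = 0\<close> by auto
    then have "0 < s * \<phi>' z" using s by simp
    then have "f (\<gamma> s) > f q" using z(3) by (simp add: \<gamma>_def)
    then show False using d(2)[OF near[of s]] s by auto
  qed
qed

lemma has_derivative_pd:
  assumes "f differentiable (at q within V)"
  shows "(f has_derivative (\<lambda>v. pd V 1 f q * v $ 1 + pd V 2 f q * v $ 2)) (at q within V)"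
proof -
  define D where "D = frechet_derivative f (at q within V)"
  have D: "(f has_derivative D) (at q within V)"
    using assms by (simp add: D_def frechet_derivative_works)
  interpret bounded_linear D using D by (rule has_derivative_bounded_linear)
  have "D v = pd V 1 f q * v $ 1 + pd V 2 f q * v $ 2" for v
  proof -
    have "v = v $ 1 *\<^sub>R axis 1 1 + v $ 2 *\<^sub>R axis 2 1"
      by (auto simp: vec_eq_iff axis_def forall_2)
    then have "D v = v $ 1 * D (axis 1 1) + v $ 2 * D (axis 2 1)"
      by (metis add scaleR real_scaleR_def)
    then show ?thesis by (simp add: pd_def D_def)
  qed
  then have "D = (\<lambda>v. pd V 1 f q * v $ 1 + pd V 2 f q * v $ 2)" by blast
  then show ?thesis using D by simp
qed

section \<open>The metric in a chart\<close>

definition pos_def_sym :: "real^2^2 \<Rightarrow> bool" where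
  "pos_def_sym G \<longleftrightarrow> transpose G = G \<and> (\<forall>v. v \<noteq> 0 \<longrightarrow> 0 < v \<bullet> (G *v v))"

lemma pos_def_sym_entries:
  assumes "pos_def_sym G"
  shows "G $ 2 $ 1 = G $ 1 $ 2" and "0 < G $ 1 $ 1" and "0 < det G"
proof -
  have pos: "0 < v \<bullet> (G *v v)" if "v \<noteq> 0" for v
    using assms that by (auto simp: pos_def_sym_def)
  have form: "v \<bullet> (G *v v) = v $ 1 * (G $ 1 $ 1 * v $ 1 + G $ 1 $ 2 * v $ 2) + v $ 2 * (G $ 2 $ 1 * v $ 1 + G $ 2 $ 2 * v $ 2)" for v
    by (simp add: inner_vec_def matrix_vector_mult_def sum_2)
  have "transpose G $ 1 $ 2 = G $ 1 $ 2"
    using assms by (simp add: pos_def_sym_def)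
  then show sym: "G $ 2 $ 1 = G $ 1 $ 2"
    by (simp add: transpose_def)
  have "axis 1 1 \<noteq> (0 :: real^2)" by (simp add: axis_eq_0_iff)
  from pos[OF this] show g11: "0 < G $ 1 $ 1"
    by (simp add: form) (simp add: axis_def)
  \<comment> \<open>The quadratic form evaluated at this vector equals
    \<open>G $ 1 $ 1 * det G\<close>.\<close>
  define v :: "real^2" where "v = vector [G $ 1 $ 2, - (G $ 1 $ 1)]"
  have "v \<noteq> 0"
    using g11 by (auto simp: v_def vec_eq_iff forall_2)
  from pos[OF this] have "0 < G $ 1 $ 1 * det G"
    by (simp add: form v_def det_2 sym algebra_simps)
  then show "0 < det G"
    using g11 zero_less_mult_pos by blast
qed

text \<open>The adjugate formula; in the index type \<open>2\<close>, \<open>3 - i\<close> is the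
  other index. As \<open>matrix_inv\<close> is a choice, the adjugate first witnesses that an
  inverse exists and is then identified with it by uniqueness of two-sided inverses.\<close>

lemma matrix_inv_2:
  fixes G :: "real^2^2"
  assumes "det G \<noteq> 0"
  shows "matrix_inv G = (\<chi> i j. if i = j then G $ (3 - i) $ (3 - i) / det G else - (G $ i $ j) / det G)"
    (is "_ = ?B")
proof -
  have d: "G $ 1 $ 1 * G $ 2 $ 2 - G $ 1 $ 2 * G $ 2 $ 1 \<noteq> 0"
    using assms by (simp add: det_2)
  have B: "G ** ?B = mat 1" "?B ** G = mat 1"
    using d by (auto simp: vec_eq_iff forall_2 matrix_matrix_mult_def sum_2 mat_def det_2 divide_simps)
  have inv: "G ** matrix_inv G = mat 1 \<and> matrix_inv G ** G = mat 1"
    unfolding matrix_inv_def by (rule someI[of _ ?B]) (rule conjI[OF B])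
  have "matrix_inv G = (?B ** G) ** matrix_inv G"
    by (simp only: B(2) matrix_mul_lid)
  also have "\<dots> = ?B ** (G ** matrix_inv G)"
    by (simp only: matrix_mul_assoc)
  also have "\<dots> = ?B"
    using inv by (simp only: matrix_mul_rid)
  finally show ?thesis .
qed

text \<open>A real \<open>2 \<times> 2\<close> positive definite form is a sum of two squares, which reduces the trace to
  two second directional derivatives.\<close>

lemma trace_matrix_inv_nonpos:
  fixes H :: "2 \<Rightarrow> 2 \<Rightarrow> real"
  assumes G: "pos_def_sym G"
    and H: "\<And>\<xi> :: real^2. (\<Sum>i\<in>UNIV. \<Sum>j\<in>UNIV. H i j * \<xi> $ i * \<xi> $ j) \<le> 0"
  shows "(\<Sum>i\<in>UNIV. \<Sum>j\<in>UNIV. matrix_inv G $ i $ j * H i j) \<le> 0"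
proof -
  note e = pos_def_sym_entries[OF G]
  define a b d where "a = G $ 1 $ 1" and "b = G $ 1 $ 2" and "d = G $ 2 $ 2"
  have a: "0 < a" and dt: "det G = a * d - b * b"
    using e by (auto simp: a_def b_def d_def det_2)
  have q1: "H 1 1 \<le> 0"
    using H[of "vector [1, 0]"] by (simp add: sum_2)
  \<comment> \<open>As quadratic forms, \<open>a\<close> times the adjugate of \<open>G\<close> is
    \<open>det G\<close> times the square along \<open>(1, 0)\<close> plus the square along
    \<open>(- b, a)\<close>.\<close>
  have q2: "H 1 1 * b * b - (H 1 2 + H 2 1) * a * b + H 2 2 * a * a \<le> 0"
    using H[of "vector [- b, a]"] by (simp add: sum_2 algebra_simps)
  have "(\<Sum>i\<in>UNIV. \<Sum>j\<in>UNIV. matrix_inv G $ i $ j * H i j)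
      = (d * H 1 1 - b * (H 1 2 + H 2 1) + a * H 2 2) / det G"
    using e by (simp add: matrix_inv_2 sum_2 a_def b_def d_def divide_simps algebra_simps)
  also have "\<dots> \<le> 0"
  proof -
    have "a * (d * H 1 1 - b * (H 1 2 + H 2 1) + a * H 2 2)
      = det G * H 1 1 + (H 1 1 * b * b - (H 1 2 + H 2 1) * a * b + H 2 2 * a * a)"
      by (simp add: dt algebra_simps)
    also have "\<dots> \<le> 0"
      by (rule add_nonpos_nonpos[OF mult_nonneg_nonpos[OF less_imp_le[OF e(3)] q1] q2])
    finally have "d * H 1 1 - b * (H 1 2 + H 2 1) + a * H 2 2 \<le> 0"
      using a by (simp add: mult_le_0_iff)
    then show ?thesis using e(3) by (simp add: divide_nonpos_pos)
  qed
  finally show ?thesis .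
qed

text \<open>Orthogonality to the boundary makes \<nu> a multiple of \<open>(b, - a)\<close>, where
  \<open>(a, b)\<close> is the first row of the metric; unit length fixes the factor up to sign, and
  \<open>\<nu> $ 2 < 0\<close> fixes the sign.\<close>

lemma outward_normal_2:
  assumes "pos_def_sym (G p)"
  defines "D \<equiv> sqrt (G p $ 1 $ 1 * det (G p))"
  shows "outward_normal G p = vector [G p $ 1 $ 2 / D, - (G p $ 1 $ 1) / D]"
proof -
  note e = pos_def_sym_entries[OF assms(1)]
  define a b d where "a = G p $ 1 $ 1" and "b = G p $ 1 $ 2" and "d = G p $ 2 $ 2"
  have g: "G p $ 1 $ 1 = a" "G p $ 1 $ 2 = b" "G p $ 2 $ 1 = b" "G p $ 2 $ 2 = d"
    using e by (auto simp: a_def b_def d_def)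
  have a: "0 < a" and dt: "det (G p) = a * d - b * b" and dpos: "0 < a * d - b * b"
    using e by (auto simp: g det_2)
  have D: "D > 0" "D * D = a * (a * d - b * b)"
    using a dpos by (auto simp: D_def g dt)
  have exp1: "axis 1 1 \<bullet> (G p *v \<nu>) = a * \<nu> $ 1 + b * \<nu> $ 2" for \<nu>
    by (simp add: inner_axis' matrix_vector_mult_def sum_2 g)
  have exp2: "\<nu> \<bullet> (G p *v \<nu>) = \<nu> $ 1 * (a * \<nu> $ 1 + b * \<nu> $ 2) + \<nu> $ 2 * (b * \<nu> $ 1 + d * \<nu> $ 2)" for \<nu>
    by (simp add: inner_vec_def matrix_vector_mult_def sum_2 g)
  define N :: "real^2" where "N = vector [b / D, - a / D]"
  show ?thesis
    unfolding outward_normal_def g N_def[symmetric]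
  proof (rule the_equality)
    have "b / D * (a * (b / D) + b * (- a / D)) + - a / D * (b * (b / D) + d * (- a / D)) = a * (a * d - b * b) / (D * D)"
      using D(1) by (simp add: field_simps)
    also have "\<dots> = 1"
      unfolding D(2) by (rule divide_self) (use a dpos in \<open>simp only: mult_eq_0_iff, linarith\<close>)
    finally have "N \<bullet> (G p *v N) = 1"
      unfolding exp2 N_def by simp
    moreover have "axis 1 1 \<bullet> (G p *v N) = 0"
      unfolding exp1 N_def by simp
    moreover have "N $ 2 < 0"
      using D(1) a by (simp add: N_def)
    ultimately show "axis 1 1 \<bullet> (G p *v N) = 0 \<and> N \<bullet> (G p *v N) = 1 \<and> N $ 2 < 0"
      by (intro conjI)
  next
    fix \<nu> :: "real^2"
    assume \<nu>: "axis 1 1 \<bullet> (G p *v \<nu>) = 0 \<and> \<nu> \<bullet> (G p *v \<nu>) = 1 \<and> \<nu> $ 2 < 0"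
    have 1: "a * \<nu> $ 1 + b * \<nu> $ 2 = 0"
      unfolding exp1[symmetric] using \<nu> by (elim conjE)
    have "\<nu> $ 1 * (a * \<nu> $ 1 + b * \<nu> $ 2) + \<nu> $ 2 * (b * \<nu> $ 1 + d * \<nu> $ 2) = 1"
      unfolding exp2[symmetric] using \<nu> by (elim conjE)
    then have 2: "\<nu> $ 2 * (b * \<nu> $ 1 + d * \<nu> $ 2) = 1"
      unfolding 1 by simp
    have "a * (\<nu> $ 2 * (b * \<nu> $ 1 + d * \<nu> $ 2))
        = b * \<nu> $ 2 * (a * \<nu> $ 1 + b * \<nu> $ 2) + (a * d - b * b) * (\<nu> $ 2 * \<nu> $ 2)"
      by (simp add: algebra_simps)
    then have "(a * d - b * b) * (\<nu> $ 2 * \<nu> $ 2) = a"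
      unfolding 1 2 by simp
    then have "a * a = (a * (a * d - b * b)) * (\<nu> $ 2 * \<nu> $ 2)"
      by (simp only: mult.assoc)
    also have "\<dots> = (- (D * \<nu> $ 2)) * (- (D * \<nu> $ 2))"
      unfolding D(2)[symmetric] by (simp add: mult.assoc mult.left_commute)
    finally have sq: "a\<^sup>2 = (- (D * \<nu> $ 2))\<^sup>2" by (simp only: power2_eq_square)
    have "\<nu> $ 2 < 0" using \<nu> by (elim conjE)
    then have "0 \<le> - (D * \<nu> $ 2)" using D(1) by (simp add: mult_nonneg_nonpos)
    then have "a = - (D * \<nu> $ 2)"
      by (rule power2_eq_imp_eq[OF sq less_imp_le[OF a]])
    then have n2: "\<nu> $ 2 = - a / D"
      using D(1) by (simp add: divide_simps mult.commute)
    have "a * \<nu> $ 1 + b * (- a / D) = 0" using 1 n2 by simp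
    then have "a * \<nu> $ 1 = a * (b / D)" by (simp add: mult.commute)
    then have "\<nu> $ 1 = b / D" using a mult_left_cancel[of a] by blast
    then show "\<nu> = N"
      using n2 by (simp add: N_def vec_eq_iff forall_2)
  qed
qed

lemma normal_deriv_2:
  assumes "pos_def_sym (G p)"
  shows "normal_deriv V G f p = (G p $ 1 $ 2 * pd V 1 f p - G p $ 1 $ 1 * pd V 2 f p) / sqrt (G p $ 1 $ 1 * det (G p))"
  unfolding normal_deriv_def outward_normal_2[of G p, OF assms]
  by (simp add: sum_2 diff_divide_distrib)

text \<open>The Laplace-Beltrami operator with formal values \<open>D\<close> and \<open>H\<close>
  for the first and second derivatives. Being linear in them, it can be evaluated on the explicit
  derivatives of a barrier and on differences without further differentiation.\<close>

definition second_order :: "(real^2) set \<Rightarrow> (real^2 \<Rightarrow> real^2^2) \<Rightarrow> real^2 \<Rightarrow> (2 \<Rightarrow> real) \<Rightarrow> (2 \<Rightarrow> 2 \<Rightarrow> real) \<Rightarrow> real" where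
  "second_order V G p D H =
     (\<Sum>i\<in>UNIV. \<Sum>j\<in>UNIV. matrix_inv (G p) $ i $ j * (H i j - (\<Sum>k\<in>UNIV. christoffel V G k i j p * D k)))"

lemma laplacian_conv_second_order:
  "laplacian V G f p = second_order V G p (\<lambda>k. pd V k f p) (\<lambda>i j. pd V i (pd V j f) p)"
  by (simp add: laplacian_def second_order_def)

lemma continuous_on_second_order:
  assumes G: "\<And>i j. smooth_on V (\<lambda>p. G p $ i $ j)" "\<And>p. p \<in> V \<Longrightarrow> pos_def_sym (G p)"
    and D: "\<And>k. continuous_on V (D k)" and H: "\<And>i j. continuous_on V (H i j)"
  shows "continuous_on V (\<lambda>p. second_order V G p (\<lambda>k. D k p) (\<lambda>i j. H i j p))"
proof -
  have "Ck_on 1 V (\<lambda>p. G p $ i $ j)" for i j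
    using G(1) unfolding smooth_on_def by blast
  then have g: "continuous_on V (\<lambda>p. G p $ i $ j)"
    and dg: "continuous_on V (pd V k (\<lambda>p. G p $ i $ j))" for i j k
    by (auto intro: differentiable_imp_continuous_on)
  have det: "continuous_on V (\<lambda>p. det (G p))"
    unfolding det_2 by (intro continuous_intros g)
  have det0: "det (G p) \<noteq> 0" if "p \<in> V" for p
    using pos_def_sym_entries(3)[OF G(2)[OF that]] by simp
  have inv: "continuous_on V (\<lambda>p. matrix_inv (G p) $ i $ j)" for i j
  proof -
    have "continuous_on V (\<lambda>p. if i = j then G p $ (3 - i) $ (3 - i) / det (G p) else - (G p $ i $ j) / det (G p))"
      using det0 by (cases "i = j") (auto intro!: continuous_intros g det)
    then show ?thesis
      by (rule continuous_on_eq) (simp add: matrix_inv_2 det0)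
  qed
  have "continuous_on V (christoffel V G k i j)" for k i j
    unfolding christoffel_def by (intro continuous_intros inv dg) auto
  then show ?thesis
    unfolding second_order_def by (intro continuous_intros inv D H)
qed

text \<open>At an interior maximum of \<open>f1 - f2 - m * e\<close> the gradient vanishes, which
  removes the Christoffel terms, and the trace of the Hessian against the inverse metric is
  nonpositive. Linearity of \<open>second_order\<close> then separates the three
  contributions.\<close>

lemma laplacian_at_maximum:
  fixes f1 f2 e :: "real^2 \<Rightarrow> real" and E :: "2 \<Rightarrow> real^2 \<Rightarrow> real"
  assumes V: "openin (top_of_set half_plane) V" and q: "q \<in> V" "0 < q $ 2"
    and G: "pos_def_sym (G q)"
    and f1: "f1 differentiable_on V" "\<And>j. pd V j f1 differentiable_on V"
    and f2: "f2 differentiable_on V" "\<And>j. pd V j f2 differentiable_on V"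
    and e: "\<And>y. (e has_derivative (\<lambda>v. E 1 y * v $ 1 + E 2 y * v $ 2)) (at y)"
    and E: "\<And>j. (E j has_derivative (\<lambda>v. H 1 j * v $ 1 + H 2 j * v $ 2)) (at q)"
    and max: "eventually (\<lambda>y. f1 y - f2 y - m * e y \<le> f1 q - f2 q - m * e q) (nhds q)"
  shows "laplacian V G f1 q - laplacian V G f2 q \<le> m * second_order V G q (\<lambda>k. E k q) H"
proof -
  define h where "h = (\<lambda>j y. pd V j f1 y - pd V j f2 y - m * E j y)"
  define K where "K = (\<lambda>i j. pd V i (pd V j f1) q - pd V i (pd V j f2) q - m * H i j)"
  have pd: "(f has_derivative (\<lambda>v. pd V 1 f y * v $ 1 + pd V 2 f y * v $ 2)) (at y)"
    if "f differentiable_on V" "y \<in> V" "0 < y $ 2" for f y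
  proof -
    have "(f has_derivative (\<lambda>v. pd V 1 f y * v $ 1 + pd V 2 f y * v $ 2)) (at y within V)"
      by (rule has_derivative_pd) (use that in \<open>simp add: differentiable_on_def\<close>)
    then show ?thesis
      using at_within_half_plane_interior(1)[OF V that(2,3)] by simp
  qed
  have "eventually (\<lambda>y. y \<in> interior V \<inter> {p. 0 < p $ 2}) (nhds q)"
    using q at_within_half_plane_interior[OF V q]
    by (intro eventually_nhds_in_open open_Int open_interior open_Collect_less continuous_intros) auto
  then have A: "eventually (\<lambda>y. ((\<lambda>y. f1 y - f2 y - m * e y) has_derivative (\<lambda>v. h 1 y * v $ 1 + h 2 y * v $ 2)) (at y)) (nhds q)"
  proof eventually_elim
    case (elim y)
    then have "y \<in> V" "0 < y $ 2" using interior_subset by auto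
    note [derivative_intros] = pd[OF f1(1) this] pd[OF f2(1) this] e
    show ?case
      by (rule derivative_eq_intros refl)+ (auto simp: h_def algebra_simps)
  qed
  have B: "(h j has_derivative (\<lambda>v. K 1 j * v $ 1 + K 2 j * v $ 2)) (at q)" for j
  proof -
    note [derivative_intros] = pd[OF f1(2) q] pd[OF f2(2) q] E
    show ?thesis
      unfolding h_def by (rule derivative_eq_intros refl)+ (auto simp: K_def algebra_simps)
  qed
  have h0: "h j q = 0" for j
    by (rule interior_maximum(1)[OF A B max])
  have "(\<Sum>i\<in>UNIV. \<Sum>j\<in>UNIV. matrix_inv (G q) $ i $ j * K i j) \<le> 0"
    by (rule trace_matrix_inv_nonpos[OF G]) (rule interior_maximum(2)[OF A B max])
  then have "second_order V G q (\<lambda>k. h k q) K \<le> 0"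
    by (simp add: second_order_def h0)
  moreover have "laplacian V G f1 q - laplacian V G f2 q - m * second_order V G q (\<lambda>k. E k q) H
      = second_order V G q (\<lambda>k. h k q) K"
    by (simp add: laplacian_conv_second_order second_order_def K_def h_def sum_2 algebra_simps)
  ultimately show ?thesis by simp
qed

section \<open>Quadratic barriers\<close>

text \<open>
  With \<open>a = g_12 / g_11\<close> at a boundary point \<open>p\<close>, the linear form \<open>v_1 + a v_2\<close> is annihilated by the
  outward normal at \<open>p\<close>. On the \<open>r\<close>-ball of \<open>tilt\<close> the quadratic part of the barrier therefore
  contributes only \<open>o(1) / r\<close> to its normal derivative, while the linear part contributes a positive
  multiple of \<open>1 / r\<close>: small \<open>r\<close> beats any Robin coefficient.
\<close>

definition tilt :: "real \<Rightarrow> real^2 \<Rightarrow> real" where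
  "tilt a v = (v $ 1 + a * v $ 2)\<^sup>2 + (v $ 2)\<^sup>2"

definition barrier :: "real \<Rightarrow> real^2 \<Rightarrow> real \<Rightarrow> real^2 \<Rightarrow> real" where
  "barrier a p r q = 1 + tilt a (q - p) / r\<^sup>2 - (q - p) $ 2 / (4 * r)"

definition barrier_pd :: "real \<Rightarrow> real^2 \<Rightarrow> real \<Rightarrow> 2 \<Rightarrow> real^2 \<Rightarrow> real" where
  "barrier_pd a p r j q =
     (if j = 1 then 2 * ((q - p) $ 1 + a * (q - p) $ 2) / r\<^sup>2
      else (2 * a * ((q - p) $ 1 + a * (q - p) $ 2) + 2 * (q - p) $ 2) / r\<^sup>2 - 1 / (4 * r))"

definition barrier_pd2 :: "real \<Rightarrow> real \<Rightarrow> 2 \<Rightarrow> 2 \<Rightarrow> real" where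
  "barrier_pd2 a r i j =
     (if i = 1 \<and> j = 1 then 2 else if i = 2 \<and> j = 2 then 2 * a\<^sup>2 + 2 else 2 * a) / r\<^sup>2"

lemma vec_nth_diff_has_derivative:
  "((\<lambda>q. (q - p) $ j) has_derivative (\<lambda>v. v $ j)) (at (y :: real^2))"
  by (rule has_derivative_eq_rhs, rule bounded_linear.has_derivative[OF bounded_linear_vec_nth],
      rule has_derivative_diff[OF has_derivative_ident has_derivative_const]) simp

lemmas barrier_derivative_rules =
  has_derivative_add has_derivative_diff has_derivative_mult has_derivative_const vec_nth_diff_has_derivative
  bounded_linear.has_derivative[OF bounded_linear_divide]

lemma barrier_has_derivative:
  "(barrier a p r has_derivative (\<lambda>v. barrier_pd a p r 1 y * v $ 1 + barrier_pd a p r 2 y * v $ 2)) (at y)"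
  unfolding barrier_def tilt_def power2_eq_square
  by (rule has_derivative_eq_rhs, (rule barrier_derivative_rules)+)
    (simp add: barrier_pd_def fun_eq_iff add_divide_distrib diff_divide_distrib power2_eq_square algebra_simps)

lemma barrier_pd_has_derivative:
  "(barrier_pd a p r j has_derivative (\<lambda>v. barrier_pd2 a r 1 j * v $ 1 + barrier_pd2 a r 2 j * v $ 2)) (at y)"
proof -
  have 1: "(barrier_pd a p r 1 has_derivative (\<lambda>v. barrier_pd2 a r 1 1 * v $ 1 + barrier_pd2 a r 2 1 * v $ 2)) (at y)"
  proof -
    have *: "barrier_pd a p r 1 = (\<lambda>q. 2 * ((q - p) $ 1 + a * (q - p) $ 2) / r\<^sup>2)"
      by (simp add: barrier_pd_def fun_eq_iff)
    show ?thesis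
      unfolding *
      by (rule has_derivative_eq_rhs, (rule barrier_derivative_rules)+)
        (simp add: barrier_pd2_def fun_eq_iff add_divide_distrib diff_divide_distrib algebra_simps)
  qed
  have 2: "(barrier_pd a p r 2 has_derivative (\<lambda>v. barrier_pd2 a r 1 2 * v $ 1 + barrier_pd2 a r 2 2 * v $ 2)) (at y)"
  proof -
    have *: "barrier_pd a p r 2 = (\<lambda>q. (2 * a * ((q - p) $ 1 + a * (q - p) $ 2) + 2 * (q - p) $ 2) / r\<^sup>2 - 1 / (4 * r))"
      by (simp add: barrier_pd_def fun_eq_iff)
    show ?thesis
      unfolding *
      by (rule has_derivative_eq_rhs, (rule barrier_derivative_rules)+)
        (simp add: barrier_pd2_def fun_eq_iff add_divide_distrib diff_divide_distrib power2_eq_square algebra_simps)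
  qed
  show ?thesis
    using 1 2 exhaust_2[of j] by auto
qed

text \<open>Undoing the shear costs at most a factor depending on \<open>a\<close>, so small tilted
  balls lie in small Euclidean balls.\<close>

lemma tilt_bounds:
  assumes "tilt a v \<le> r\<^sup>2" and "0 \<le> r"
  shows "\<bar>v $ 2\<bar> \<le> r" and "\<bar>v $ 1\<bar> \<le> (1 + \<bar>a\<bar>) * r" and "norm v \<le> (2 + \<bar>a\<bar>) * r"
proof -
  have "(v $ 2)\<^sup>2 \<le> r\<^sup>2" "(v $ 1 + a * v $ 2)\<^sup>2 \<le> r\<^sup>2"
    using assms(1) zero_le_power2[of "v $ 2"] zero_le_power2[of "v $ 1 + a * v $ 2"]
    unfolding tilt_def by linarith+
  then have 1: "\<bar>v $ 2\<bar> \<le> r" and 2: "\<bar>v $ 1 + a * v $ 2\<bar> \<le> r"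
    using assms(2) by (simp_all add: abs_le_square_iff[symmetric])
  show "\<bar>v $ 2\<bar> \<le> r" by (fact 1)
  have "\<bar>a * v $ 2\<bar> \<le> \<bar>a\<bar> * r"
    using 1 by (simp add: abs_mult mult_left_mono)
  then show 3: "\<bar>v $ 1\<bar> \<le> (1 + \<bar>a\<bar>) * r"
    using 2 by (simp add: distrib_right)
  have "norm v \<le> \<bar>v $ 1\<bar> + \<bar>v $ 2\<bar>"
    using norm_le_l1_cart[of v] by (simp add: sum_2)
  then show "norm v \<le> (2 + \<bar>a\<bar>) * r"
    using 1 3 by (simp add: distrib_right)
qed

text \<open>On the ball the quadratic part lies between 0 and 1 and the linear part is at most 1/4
  in size. At the rim this gives at least \<open>2 - 1/4\<close>, at half the radius at most
  \<open>1 + 1/4 + 1/8\<close>. The gap between 7/4 and 11/8 later keeps the maximum away from the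
  rim.\<close>

lemma barrier_bounds:
  assumes "0 < r" and "tilt a (q - p) \<le> r\<^sup>2"
  shows "3 / 4 \<le> barrier a p r q" and "barrier a p r q \<le> 9 / 4"
    and "tilt a (q - p) = r\<^sup>2 \<Longrightarrow> 7 / 4 \<le> barrier a p r q"
    and "tilt a (q - p) \<le> (r / 2)\<^sup>2 \<Longrightarrow> barrier a p r q \<le> 11 / 8"
proof -
  have t: "0 \<le> tilt a (q - p) / r\<^sup>2" "tilt a (q - p) / r\<^sup>2 \<le> 1"
    using assms by (simp_all add: tilt_def)
  have "\<bar>(q - p) $ 2\<bar> \<le> r" using tilt_bounds(1)[OF assms(2)] assms(1) by simp
  then have s: "\<bar>(q - p) $ 2 / (4 * r)\<bar> \<le> 1 / 4"
    using assms(1) by (simp add: abs_mult field_simps)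
  show "3 / 4 \<le> barrier a p r q" "barrier a p r q \<le> 9 / 4"
    using s t unfolding barrier_def by linarith+
  show "7 / 4 \<le> barrier a p r q" if "tilt a (q - p) = r\<^sup>2"
  proof -
    have "tilt a (q - p) / r\<^sup>2 = 1" using that assms(1) by simp
    then show ?thesis using s unfolding barrier_def by linarith
  qed
  show "barrier a p r q \<le> 11 / 8" if h: "tilt a (q - p) \<le> (r / 2)\<^sup>2"
  proof -
    have "\<bar>(q - p) $ 2\<bar> \<le> r / 2" using tilt_bounds(1)[OF h] assms(1) by simp
    then have "\<bar>(q - p) $ 2 / (4 * r)\<bar> \<le> 1 / 8"
      using assms(1) by (simp add: abs_mult field_simps)
    moreover have "tilt a (q - p) / r\<^sup>2 \<le> 1 / 4"
      using h assms(1) by (simp add: field_simps power2_eq_square)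
    ultimately show ?thesis unfolding barrier_def by linarith
  qed
qed

section \<open>Tilted balls: compactness and shrinking\<close>

lemma compact_continuous_bounded:
  fixes f :: "'b::metric_space \<Rightarrow> real"
  assumes "compact K" and "continuous_on K f"
  obtains c where "0 < c" "\<And>x. x \<in> K \<Longrightarrow> \<bar>f x\<bar> \<le> c"
proof -
  have "bounded (f ` K)"
    using assms by (intro compact_imp_bounded compact_continuous_image)
  then obtain c where c: "0 < c" "\<forall>y\<in>f ` K. norm y \<le> c"
    unfolding bounded_pos by blast
  show ?thesis
    by (rule that[OF c(1)]) (use c(2) in auto)
qed

definition tilted_ball :: "real \<Rightarrow> real^2 \<Rightarrow> real \<Rightarrow> (real^2) set" where
  "tilted_ball a p r = {q \<in> half_plane. tilt a (q - p) \<le> r\<^sup>2}"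

lemma continuous_on_tilt: "continuous_on S (\<lambda>q. tilt a (q - p))"
  unfolding tilt_def by (intro continuous_intros)

lemma compact_tilted_ball:
  assumes "0 \<le> r"
  shows "compact (tilted_ball a p r)"
proof -
  have "closed {q :: real^2. 0 \<le> q $ 2 \<and> tilt a (q - p) \<le> r\<^sup>2}"
    by (intro closed_Collect_conj closed_Collect_le continuous_on_tilt continuous_intros)
  moreover have "tilted_ball a p r \<subseteq> cball p ((2 + \<bar>a\<bar>) * r)"
    using tilt_bounds(3)[OF _ assms] by (auto simp: tilted_ball_def dist_norm norm_minus_commute)
  ultimately show ?thesis
    using bounded_subset[OF bounded_cball]
    by (auto simp: compact_eq_bounded_closed tilted_ball_def half_plane_def)
qed

text \<open>Turns a property valid near \<open>p\<close> within \<open>V\<close> into one valid on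
  all small tilted balls. The filter leaves out \<open>p\<close> itself, hence the separate
  \<open>P p\<close>.\<close>

lemma eventually_tilted_ball:
  assumes "openin (top_of_set half_plane) V" and "p \<in> V"
    and "eventually P (at p within V)" and "P p"
  shows "\<exists>r0>0. \<forall>r q. 0 \<le> r \<and> r \<le> r0 \<and> q \<in> tilted_ball a p r \<longrightarrow> q \<in> V \<and> P q"
proof -
  obtain U where U: "open U" "V = half_plane \<inter> U"
    using assms(1) by (auto simp: openin_open)
  have "eventually (\<lambda>q. q \<in> V \<longrightarrow> P q) (nhds p)"
    using assms(3,4) by (auto simp: eventually_at_filter elim: eventually_mono)
  then have "eventually (\<lambda>q. q \<in> U \<and> (q \<in> V \<longrightarrow> P q)) (nhds p)"
    using eventually_nhds_in_open[OF U(1)] assms(2) U(2) by (intro eventually_conj) auto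
  then obtain d where d: "d > 0" "\<And>q. dist q p < d \<Longrightarrow> q \<in> U \<and> (q \<in> V \<longrightarrow> P q)"
    unfolding eventually_nhds_metric by blast
  define r0 where "r0 = d / (2 * (2 + \<bar>a\<bar>))"
  have "0 < r0" using d(1) by (simp add: r0_def)
  have r0: "(2 + \<bar>a\<bar>) * r0 = d / 2"
    by (simp add: r0_def divide_simps)
  have "q \<in> V \<and> P q" if "0 \<le> r" "r \<le> r0" "q \<in> tilted_ball a p r" for r q
  proof -
    have "norm (q - p) \<le> (2 + \<bar>a\<bar>) * r"
      using tilt_bounds(3) that by (simp add: tilted_ball_def)
    also have "\<dots> \<le> (2 + \<bar>a\<bar>) * r0"
      using that by (intro mult_left_mono) auto
    also have "\<dots> < d" using r0 d(1) by simp
    finally show ?thesis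
      using d(2)[of q] that(3) U(2) by (auto simp: dist_norm tilted_ball_def)
  qed
  with \<open>0 < r0\<close> show ?thesis by blast
qed

section \<open>Touching points of a barrier in one chart\<close>

lemma eventually_tilt_less:
  assumes "tilt a (q - p) < r\<^sup>2"
  shows "eventually (\<lambda>y. tilt a (y - p) < r\<^sup>2) (nhds q)"
proof -
  have "open {y. tilt a (y - p) < r\<^sup>2}"
    by (intro open_Collect_less continuous_on_tilt continuous_intros)
  from eventually_nhds_in_open[OF this] show ?thesis
    using assms by simp
qed

text \<open>The weighted barrier dominates \<open>w\<close> on the whole cylinder and meets it at
  \<open>(q, t)\<close>. The rim and the initial time are excluded; boundary points of the
  half-plane and the final time \<open>t1\<close> are allowed.\<close>

definition touches :: "(real^2 \<Rightarrow> real \<Rightarrow> real) \<Rightarrow> real \<Rightarrow> real \<Rightarrow> real^2 \<Rightarrow> real \<Rightarrow> real \<Rightarrow> real \<Rightarrow> real^2 \<Rightarrow> real \<Rightarrow> bool" where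
  "touches w t1 a p r L M q t \<longleftrightarrow>
     q \<in> half_plane \<and> tilt a (q - p) < r\<^sup>2 \<and> 0 < t \<and> t \<le> t1 \<and>
     (\<forall>y\<in>tilted_ball a p r. \<forall>s\<in>{0..t1}. w y s \<le> M * exp (L * s) * barrier a p r y) \<and>
     w q t = M * exp (L * t) * barrier a p r q"

text \<open>
  The coefficient \<open>b\<close> stands for \<open>\<psi>1\<close> in the chart: \<open>\<psi>1 \<le> \<psi>2\<close> gives
  \<open>\<psi>1 e^(u1) - \<psi>2 e^(u2) \<le> \<psi>1 (e^(u1) - e^(u2))\<close>.
\<close>

locale chart_solutions =
  fixes V :: "(real^2) set" and G :: "real^2 \<Rightarrow> real^2^2"
    and f1 f2 b :: "real^2 \<Rightarrow> real \<Rightarrow> real" and t1 :: real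
  assumes V: "openin (top_of_set half_plane) V"
    and G_smooth: "\<And>i j. smooth_on V (\<lambda>p. G p $ i $ j)"
    and G_pos: "\<And>p. p \<in> V \<Longrightarrow> pos_def_sym (G p)"
    and diff1: "\<And>t. t \<in> {0..t1} \<Longrightarrow> (\<lambda>q. f1 q t) differentiable_on V"
      "\<And>t j. t \<in> {0..t1} \<Longrightarrow> pd V j (\<lambda>q. f1 q t) differentiable_on V"
    and diff2: "\<And>t. t \<in> {0..t1} \<Longrightarrow> (\<lambda>q. f2 q t) differentiable_on V"
      "\<And>t j. t \<in> {0..t1} \<Longrightarrow> pd V j (\<lambda>q. f2 q t) differentiable_on V"
    and cont1: "continuous_on (V \<times> {0..t1}) (\<lambda>(q, t). f1 q t)"
    and cont2: "continuous_on (V \<times> {0..t1}) (\<lambda>(q, t). f2 q t)"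
    and cont2': "continuous_on (V \<times> {0..t1}) (\<lambda>(q, t). exp (- 2 * f2 q t) * laplacian V G (\<lambda>y. f2 y t) q)"
    and pde1: "\<And>q t. q \<in> V \<Longrightarrow> t \<in> {0..t1} \<Longrightarrow>
      (f1 q has_real_derivative exp (- 2 * f1 q t) * laplacian V G (\<lambda>y. f1 y t) q - 1) (at t within {0..t1})"
    and pde2: "\<And>q t. q \<in> V \<Longrightarrow> t \<in> {0..t1} \<Longrightarrow>
      (f2 q has_real_derivative exp (- 2 * f2 q t) * laplacian V G (\<lambda>y. f2 y t) q - 1) (at t within {0..t1})"
    and bdry: "\<And>q t. q \<in> V \<Longrightarrow> q $ 2 = 0 \<Longrightarrow> t \<in> {0..t1} \<Longrightarrow>
      normal_deriv V G (\<lambda>y. f1 y t) q - normal_deriv V G (\<lambda>y. f2 y t) q \<le> b q t * (exp (f1 q t) - exp (f2 q t))"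
    and contb: "continuous_on ({s. vector [s, 0] \<in> V} \<times> {0..t1}) (\<lambda>(s, t). b (vector [s, 0]) t)"
begin

abbreviation gap :: "real^2 \<Rightarrow> real \<Rightarrow> real" where
  "gap \<equiv> \<lambda>y s. f1 y s - f2 y s"

text \<open>The denominator in the explicit outward normal: multiplied by it,
  \<open>normal_deriv\<close> is linear in the metric coefficients.\<close>

definition normal_scale :: "real^2 \<Rightarrow> real" where
  "normal_scale q = sqrt (G q $ 1 $ 1 * det (G q))"

lemma touches_maximum:
  assumes "touches gap t1 a p r L M q t"
  shows "eventually (\<lambda>y. y \<in> half_plane \<longrightarrow> f1 y t - f2 y t - (M * exp (L * t)) * barrier a p r y
      \<le> f1 q t - f2 q t - (M * exp (L * t)) * barrier a p r q) (nhds q)"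
proof -
  have "eventually (\<lambda>y. tilt a (y - p) < r\<^sup>2) (nhds q)"
    using assms by (intro eventually_tilt_less) (simp add: touches_def)
  then show ?thesis
    by eventually_elim (use assms in \<open>auto simp: touches_def tilted_ball_def\<close>)
qed

text \<open>Going back in time from the touching point bounds \<open>L * w\<close> by the difference
  of the two terms \<open>exp (- 2 * f) * laplacian\<close>, while the maximum in space bounds that
  difference by a fixed multiple of \<open>w\<close>. A rate \<open>L\<close> above this multiple is
  impossible.\<close>

lemma touches_interior_False:
  assumes r: "0 < r" "tilted_ball a p r \<subseteq> V" and M: "0 < M"
    and touch: "touches gap t1 a p r L M q t" and q2: "0 < q $ 2"
    and K: "exp (- 2 * f1 q t) \<le> K1" "\<bar>exp (- 2 * f2 q t) * laplacian V G (\<lambda>y. f2 y t) q\<bar> \<le> K2"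
      "\<bar>second_order V G q (\<lambda>k. barrier_pd a p r k q) (barrier_pd2 a r)\<bar> \<le> K3"
    and L: "4 / 3 * K1 * K3 + 2 * K2 < L"
  shows False
proof -
  have t: "0 < t" "t \<in> {0..t1}" and ball: "q \<in> tilted_ball a p r"
    and eq: "f1 q t - f2 q t = M * exp (L * t) * barrier a p r q"
    and le: "\<And>s. s \<in> {0..t1} \<Longrightarrow> f1 q s - f2 q s \<le> M * exp (L * s) * barrier a p r q"
    using touch by (auto simp: touches_def tilted_ball_def)
  have q: "q \<in> V" using ball r by blast
  define w m where "w = f1 q t - f2 q t" and "m = M * exp (L * t)"
  have m: "0 < m" using M by (simp add: m_def)
  have w: "w = m * barrier a p r q" using eq by (simp add: w_def m_def)
  have B: "3 / 4 \<le> barrier a p r q"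
    using barrier_bounds(1)[OF r(1)] ball by (simp add: tilted_ball_def)
  \<comment> \<open>The lower bound 3/4 on the barrier is the source of the factor 4/3 in the
    threshold for \<open>L\<close>.\<close>
  have mw: "m \<le> 4 / 3 * w"
    using mult_left_mono[OF B less_imp_le[OF m]] w by simp
  have w0: "0 < w" using mw m by simp
  define S where "S = second_order V G q (\<lambda>k. barrier_pd a p r k q) (barrier_pd2 a r)"
  define l1 l2 where "l1 = laplacian V G (\<lambda>y. f1 y t) q" and "l2 = laplacian V G (\<lambda>y. f2 y t) q"
  have int: "q \<in> interior V"
    by (rule at_within_half_plane_interior(2)[OF V q q2])
  have "eventually (\<lambda>y. f1 y t - f2 y t - m * barrier a p r y \<le> f1 q t - f2 q t - m * barrier a p r q) (nhds q)"
  proof -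
    have "eventually (\<lambda>y. y \<in> interior V) (nhds q)"
      using int by (intro eventually_nhds_in_open) auto
    then show ?thesis
      using touches_maximum[OF touch]
      by eventually_elim (use V openin_imp_subset[OF V] interior_subset[of V] in \<open>auto simp: m_def\<close>)
  qed
  then have lap: "l1 - l2 \<le> m * S"
    unfolding l1_def l2_def S_def
    by (rule laplacian_at_maximum[where G = G and e = "barrier a p r" and m = m
          and ?f1.0 = "\<lambda>y. f1 y t" and ?f2.0 = "\<lambda>y. f2 y t" and E = "barrier_pd a p r" and H = "barrier_pd2 a r",
          OF V q q2 G_pos[OF q] diff1(1)[OF t(2)] diff1(2)[OF t(2)] diff2(1)[OF t(2)] diff2(2)[OF t(2)]
          barrier_has_derivative barrier_pd_has_derivative])
  have "((\<lambda>s. f1 q s - f2 q s - M * exp (L * s) * barrier a p r q) has_real_derivative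
      ((exp (- 2 * f1 q t) * l1 - 1) - (exp (- 2 * f2 q t) * l2 - 1) - L * w)) (at t within {0..t1})"
  proof -
    note [derivative_intros] = pde1[OF q t(2)] pde2[OF q t(2)]
    show ?thesis
      unfolding l1_def l2_def by (rule derivative_eq_intros refl)+ (simp add: w m_def)
  qed
  then have "((\<lambda>s. f1 q s - f2 q s - M * exp (L * s) * barrier a p r q) has_derivative
      (\<lambda>h. ((exp (- 2 * f1 q t) * l1 - 1) - (exp (- 2 * f2 q t) * l2 - 1) - L * w) * h)) (at t within {0..t1})"
    by (simp add: has_field_derivative_def)
  \<comment> \<open>Since \<open>t\<close> may equal \<open>t1\<close>, the maximum in time is
    tested only backwards, in direction \<open>- 1\<close>.\<close>
  then have "((exp (- 2 * f1 q t) * l1 - 1) - (exp (- 2 * f2 q t) * l2 - 1) - L * w) * (- 1) \<le> 0"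
  proof (rule has_derivative_max_direction[OF _ t(1)])
    fix h assume "0 \<le> h" "h < t"
    then have "t + h *\<^sub>R (- 1) \<in> {0..t1}" using t by simp
    from this le[OF this] eq
    show "t + h *\<^sub>R (- 1) \<in> {0..t1} \<and>
      f1 q (t + h *\<^sub>R (- 1)) - f2 q (t + h *\<^sub>R (- 1)) - M * exp (L * (t + h *\<^sub>R (- 1))) * barrier a p r q
      \<le> f1 q t - f2 q t - M * exp (L * t) * barrier a p r q"
      by simp
  qed
  then have Lw: "L * w \<le> exp (- 2 * f1 q t) * l1 - exp (- 2 * f2 q t) * l2"
    by simp
  define R where "R = exp (- 2 * f2 q t) * l2"
  \<comment> \<open>Putting both Laplacians under the coefficient \<open>exp (- 2 * f1 q t)\<close>
    leaves the bounded factor \<open>R\<close> times \<open>exp (- 2 * w) - 1\<close>, whose size is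
    at most \<open>2 * w\<close>; this yields the summand \<open>2 * K2\<close>.\<close>
  have split: "exp (- 2 * f1 q t) * l1 - R = exp (- 2 * f1 q t) * (l1 - l2) + R * (exp (- 2 * w) - 1)"
  proof -
    have "exp (- 2 * f1 q t) = exp (- 2 * f2 q t) * exp (- 2 * w)"
      by (simp add: w_def algebra_simps flip: exp_add)
    then show ?thesis by (simp add: R_def algebra_simps)
  qed
  have K0: "0 \<le> K1" "0 \<le> K2" "0 \<le> K3"
    using K order_trans[OF exp_ge_zero] order_trans[OF abs_ge_zero] by blast+
  have "exp (- 2 * f1 q t) * (l1 - l2) \<le> exp (- 2 * f1 q t) * (m * K3)"
  proof (rule mult_left_mono)
    have "m * S \<le> m * K3" using K(3) m by (simp add: S_def)
    then show "l1 - l2 \<le> m * K3" using lap by linarith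
  qed simp
  also have "\<dots> \<le> K1 * (4 / 3 * w * K3)"
    using K(1) K0 mw m by (intro mult_mono mult_right_mono) auto
  finally have A1: "exp (- 2 * f1 q t) * (l1 - l2) \<le> K1 * (4 / 3 * w * K3)" .
  have "\<bar>exp (- 2 * w) - 1\<bar> \<le> 2 * w"
    using exp_ge_add_one_self[of "- 2 * w"] w0 by (simp add: abs_if)
  then have "\<bar>R * (exp (- 2 * w) - 1)\<bar> \<le> K2 * (2 * w)"
    unfolding abs_mult using K(2) K0 by (intro mult_mono) (auto simp: R_def l2_def)
  with Lw split A1 have "L * w \<le> K1 * (4 / 3 * w * K3) + K2 * (2 * w)"
    unfolding R_def by linarith
  then have "L * w \<le> (4 / 3 * K1 * K3 + 2 * K2) * w"
    by (simp add: algebra_simps)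
  then show False
    using L w0 by simp
qed

text \<open>The tangential derivatives of the gap and of \<open>m * barrier\<close> agree, and the
  outward component of the gap can only be larger, so its normal derivative is at least that of the
  barrier, which is of order \<open>m / r\<close>. The boundary inequality allows only a fixed
  multiple of \<open>m\<close>. The constant 18 is 8 times the upper bound 9/4 of the
  barrier.\<close>

lemma touches_boundary_False:
  assumes r: "0 < r" "tilted_ball a p r \<subseteq> V" and M: "0 < M"
    and touch: "touches gap t1 a p r L M q t" and q2: "q $ 2 = 0" "p $ 2 = 0"
    and g: "\<bar>G q $ 1 $ 2 - a * G q $ 1 $ 1\<bar> \<le> G q $ 1 $ 1 / 16"
    and C: "\<bar>b q t\<bar> * exp (f1 q t) \<le> C" "18 * r * normal_scale q * C < G q $ 1 $ 1"
  shows False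
proof -
  have t: "0 < t" "t \<in> {0..t1}" and ball: "q \<in> tilted_ball a p r"
    and eq: "f1 q t - f2 q t = M * exp (L * t) * barrier a p r q"
    using touch by (auto simp: touches_def tilted_ball_def)
  have q: "q \<in> V" using ball r by blast
  note pos = pos_def_sym_entries[OF G_pos[OF q]]
  define w m D v where "w = f1 q t - f2 q t" and "m = M * exp (L * t)" and "D = normal_scale q" and "v = (q - p) $ 1"
  define g11 g12 where "g11 = G q $ 1 $ 1" and "g12 = G q $ 1 $ 2"
  have m: "0 < m" using M by (simp add: m_def)
  have D: "0 < D" using pos by (simp add: D_def normal_scale_def)
  have g11: "0 < g11" using pos by (simp add: g11_def)
  have B: "3 / 4 \<le> barrier a p r q" "barrier a p r q \<le> 9 / 4"
    using barrier_bounds(1,2)[OF r(1)] ball by (simp_all add: tilted_ball_def)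
  have w: "w = m * barrier a p r q" using eq by (simp add: w_def m_def)
  then have w0: "0 < w" using m B by simp
  have wm: "w \<le> 9 / 4 * m" using w m B(2) by simp
  define d1 d2 where "d1 = (\<lambda>j. pd V j (\<lambda>y. f1 y t) q)" and "d2 = (\<lambda>j. pd V j (\<lambda>y. f2 y t) q)"
  have "((\<lambda>y. f1 y t - f2 y t - m * barrier a p r y) has_derivative
     (\<lambda>v. (d1 1 * v $ 1 + d1 2 * v $ 2) - (d2 1 * v $ 1 + d2 2 * v $ 2)
        - m * (barrier_pd a p r 1 q * v $ 1 + barrier_pd a p r 2 q * v $ 2))) (at q within V)"
    unfolding d1_def d2_def using diff1(1)[OF t(2)] diff2(1)[OF t(2)] q
    by (intro has_derivative_diff has_derivative_mult_right has_derivative_pd has_derivative_at_withinI[OF barrier_has_derivative])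
      (auto simp: differentiable_on_def)
  from boundary_maximum[OF V q q2(1) this] touches_maximum[OF touch]
  have d: "d1 1 - d2 1 = m * barrier_pd a p r 1 q" "d1 2 - d2 2 \<le> m * barrier_pd a p r 2 q"
    by (simp_all add: m_def axis_def)
  have vr: "\<bar>v\<bar> \<le> r"
  proof -
    have "v\<^sup>2 \<le> r\<^sup>2" using ball q2 by (simp add: tilted_ball_def tilt_def v_def)
    then show ?thesis using r(1) by (simp add: abs_le_square_iff[symmetric])
  qed
  have "m * (g11 / (8 * r)) \<le> m * (g12 * barrier_pd a p r 1 q - g11 * barrier_pd a p r 2 q)"
  proof (rule mult_left_mono)
    \<comment> \<open>With \<open>p\<close> and \<open>q\<close> both on the boundary line, the
      quadratic part enters only through \<open>g12 - a * g11\<close>. The hypothesis on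
      \<open>G q\<close> keeps its contribution within half of the gain \<open>g11 / (4 * r)\<close>
      from the linear part.\<close>
    define z where "z = (2 * v / r) * (g12 - a * g11)"
    have "g12 * barrier_pd a p r 1 q - g11 * barrier_pd a p r 2 q = z / r + g11 / (4 * r)"
      using r(1) q2 by (simp add: z_def barrier_pd_def v_def power2_eq_square field_simps)
    moreover have "\<bar>z\<bar> \<le> 2 * (g11 / 16)"
      unfolding abs_mult z_def using vr r(1) g
      by (intro mult_mono) (auto simp: g11_def g12_def pos_divide_le_eq abs_mult)
    then have "- (2 * (g11 / 16)) / r \<le> z / r"
      using r(1) by (intro divide_right_mono) linarith+
    moreover have "- (2 * (g11 / 16)) / r + g11 / (4 * r) = g11 / (8 * r)"
      using r(1) by (simp add: field_simps)
    ultimately show "g11 / (8 * r) \<le> g12 * barrier_pd a p r 1 q - g11 * barrier_pd a p r 2 q"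
      by linarith
  qed (use m in simp)
  also have "\<dots> = g12 * (d1 1 - d2 1) - g11 * (m * barrier_pd a p r 2 q)"
    by (simp add: d algebra_simps)
  also have "\<dots> \<le> g12 * (d1 1 - d2 1) - g11 * (d1 2 - d2 2)"
    using d(2) g11 by simp
  also have "\<dots> = D * (normal_deriv V G (\<lambda>y. f1 y t) q - normal_deriv V G (\<lambda>y. f2 y t) q)"
    using D unfolding normal_deriv_2[of G q, OF G_pos[OF q]] D_def normal_scale_def[symmetric]
    by (simp add: d1_def d2_def g11_def g12_def field_simps)
  also have "\<dots> \<le> D * (9 / 4 * C * m)"
  proof (rule mult_left_mono)
    have "exp (f1 q t) - exp (f2 q t) = exp (f1 q t) * (1 - exp (- w))"
      by (simp add: w_def algebra_simps flip: exp_add)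
    also have "\<dots> \<le> exp (f1 q t) * w"
      using exp_ge_add_one_self[of "- w"] by (intro mult_left_mono) auto
    finally have 1: "exp (f1 q t) - exp (f2 q t) \<le> exp (f1 q t) * w" .
    \<comment> \<open>The coefficient \<open>b\<close> has no sign; replacing it by its absolute
      value requires this difference to be nonnegative.\<close>
    have 2: "0 \<le> exp (f1 q t) - exp (f2 q t)" using w0 by (simp add: w_def)
    have "normal_deriv V G (\<lambda>y. f1 y t) q - normal_deriv V G (\<lambda>y. f2 y t) q \<le> b q t * (exp (f1 q t) - exp (f2 q t))"
      by (rule bdry[OF q q2(1) t(2)])
    also have "\<dots> \<le> \<bar>b q t\<bar> * (exp (f1 q t) * w)"
      using 1 2 by (intro mult_mono) auto
    also have "\<dots> \<le> C * w"
      using mult_right_mono[OF C(1) less_imp_le[OF w0]] by (simp only: mult.assoc)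
    also have "\<dots> \<le> C * (9 / 4 * m)"
    proof (rule mult_left_mono[OF wm])
      have "0 \<le> \<bar>b q t\<bar> * exp (f1 q t)" by simp
      then show "0 \<le> C" using C(1) by linarith
    qed
    finally show "normal_deriv V G (\<lambda>y. f1 y t) q - normal_deriv V G (\<lambda>y. f2 y t) q \<le> 9 / 4 * C * m"
      by (simp add: mult_ac)
  qed (use D in simp)
  finally have "m * (g11 / (8 * r)) \<le> m * (9 / 4 * (D * C))"
    by (simp only: mult_ac)
  then have "g11 / (8 * r) \<le> 9 / 4 * (D * C)"
    using m mult_le_cancel_left_pos by blast
  then have "g11 \<le> 18 * r * D * C"
    using r(1) by (simp add: field_simps)
  then show False
    using C(2) by (simp add: D_def g11_def)
qed

text \<open>The choices are made in the order \<open>a\<close>, \<open>r0\<close>, bounds on the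
  \<open>r0\<close>-ball, \<open>r\<close>, \<open>L\<close>. The bounds for the solutions and for
  \<open>b\<close> do not involve \<open>r\<close>, so \<open>r\<close> can be shrunk to beat the
  boundary coefficient; this affects only \<open>K3\<close>, which \<open>L\<close> then absorbs.
  All rates from \<open>L\<close> on are covered so that finitely many barriers can share one
  rate.\<close>

lemma local_barrier:
  assumes p: "p \<in> V"
  shows "\<exists>a r L. 0 < r \<and> tilted_ball a p r \<subseteq> V \<and>
    (\<forall>L' M q t. L \<le> L' \<longrightarrow> 0 < M \<longrightarrow> \<not> touches gap t1 a p r L' M q t)"
proof -
  define a where "a = G p $ 1 $ 2 / G p $ 1 $ 1"
  have pos: "0 < G q $ 1 $ 1" "0 < det (G q)" if "q \<in> V" for q
    using pos_def_sym_entries[OF G_pos[OF that]] by auto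
  have g: "continuous_on V (\<lambda>p. G p $ i $ j)" for i j
    using G_smooth[of i j, unfolded smooth_on_def, rule_format, of 0] by simp
  have scale: "continuous_on V normal_scale"
    unfolding normal_scale_def[abs_def] det_2 by (intro continuous_intros g)
  \<comment> \<open>The requirement \<open>18 * r * normal_scale q * C < G q $ 1 $ 1\<close> amounts
    to \<open>18 * r * C * \<kappa> q < 1\<close>; by continuity, \<open>\<kappa> p + 1\<close>
    serves as a bound for \<open>\<kappa> q\<close> near \<open>p\<close>.\<close>
  define \<kappa> where "\<kappa> = (\<lambda>q. normal_scale q / G q $ 1 $ 1)"
  have "continuous_on V (\<lambda>q. \<bar>G q $ 1 $ 2 - a * G q $ 1 $ 1\<bar> - G q $ 1 $ 1 / 16)" "continuous_on V \<kappa>"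
    unfolding \<kappa>_def using pos(1) by (force intro!: continuous_intros g scale)+
  then have lim: "((\<lambda>q. \<bar>G q $ 1 $ 2 - a * G q $ 1 $ 1\<bar> - G q $ 1 $ 1 / 16) \<longlongrightarrow> \<bar>G p $ 1 $ 2 - a * G p $ 1 $ 1\<bar> - G p $ 1 $ 1 / 16) (at p within V)"
    "(\<kappa> \<longlongrightarrow> \<kappa> p) (at p within V)"
    using p unfolding continuous_on_def by blast+
  \<comment> \<open>The first conjunct holds at \<open>p\<close> because \<open>a\<close> makes the
    difference vanish there. The last one makes a ball about an interior centre avoid the boundary,
    so a boundary touching point always comes with a boundary centre.\<close>
  define P where "P = (\<lambda>q. \<bar>G q $ 1 $ 2 - a * G q $ 1 $ 1\<bar> - G q $ 1 $ 1 / 16 < 0 \<and> \<kappa> q < \<kappa> p + 1 \<and> (q $ 2 = 0 \<longrightarrow> p $ 2 = 0))"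
  have Pp: "P p"
    using pos(1)[OF p] by (simp add: P_def a_def)
  have "((\<lambda>q. q $ 2) \<longlongrightarrow> p $ 2) (at p within V)"
    by (intro tendsto_intros)
  then have "eventually (\<lambda>q. p $ 2 \<noteq> 0 \<longrightarrow> q $ 2 \<noteq> 0) (at p within V)"
    using tendsto_imp_eventually_ne[of "\<lambda>q. q $ 2" "p $ 2" "at p within V" 0] by (cases "p $ 2 = 0") auto
  moreover have "eventually (\<lambda>q. \<bar>G q $ 1 $ 2 - a * G q $ 1 $ 1\<bar> - G q $ 1 $ 1 / 16 < 0) (at p within V)"
    using Pp by (intro order_tendstoD(2)[OF lim(1)]) (simp add: P_def)
  moreover have "eventually (\<lambda>q. \<kappa> q < \<kappa> p + 1) (at p within V)"
    by (intro order_tendstoD(2)[OF lim(2)]) simp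
  ultimately have "eventually P (at p within V)"
    unfolding P_def by eventually_elim blast
  from eventually_tilted_ball[OF V p this Pp, of a] obtain r0 where "0 < r0"
    and ball0: "\<forall>r q. 0 \<le> r \<and> r \<le> r0 \<and> q \<in> tilted_ball a p r \<longrightarrow> q \<in> V \<and> P q"
    by blast
  define K where "K = tilted_ball a p r0"
  have K: "compact K" "K \<subseteq> V" "compact (K \<times> {0..t1})"
  proof -
    show "compact K"
      unfolding K_def by (rule compact_tilted_ball) (use \<open>0 < r0\<close> in simp)
    then show "compact (K \<times> {0..t1})"
      by (rule compact_Times) simp
    show "K \<subseteq> V"
      unfolding K_def using ball0 \<open>0 < r0\<close> less_imp_le by blast
  qed
  have sub: "K \<times> {0..t1} \<subseteq> V \<times> {0..t1}" using K(2) by blast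
  obtain F where F: "0 < F" "\<And>z. z \<in> K \<times> {0..t1} \<Longrightarrow> \<bar>(\<lambda>(q, t). f1 q t) z\<bar> \<le> F"
    by (rule compact_continuous_bounded[OF K(3) continuous_on_subset[OF cont1 sub]]) (erule that, blast)
  have F1: "\<bar>f1 q t\<bar> \<le> F" if "q \<in> K" "t \<in> {0..t1}" for q t
    using F(2)[of "(q, t)"] that by simp
  obtain K2 where K2: "0 < K2" "\<And>z. z \<in> K \<times> {0..t1} \<Longrightarrow>
      \<bar>(\<lambda>(q, t). exp (- 2 * f2 q t) * laplacian V G (\<lambda>y. f2 y t) q) z\<bar> \<le> K2"
    by (rule compact_continuous_bounded[OF K(3) continuous_on_subset[OF cont2' sub]]) (erule that, blast)
  have K2': "\<bar>exp (- 2 * f2 q t) * laplacian V G (\<lambda>y. f2 y t) q\<bar> \<le> K2"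
    if "q \<in> K" "t \<in> {0..t1}" for q t
    using K2(2)[of "(q, t)"] that by simp
  \<comment> \<open>Continuity of \<open>b\<close> is given only along the boundary, parametrised by
    the first coordinate, so compactness is applied to the projection of the boundary points of
    \<open>K\<close>.\<close>
  define B where "B = (\<lambda>q. q $ 1) ` (K \<inter> {q. q $ 2 = 0})"
  have vec: "vector [q $ 1, 0] = q" if "q $ 2 = 0" for q :: "real^2"
    using that by (simp add: vec_eq_iff forall_2)
  have "compact B"
    unfolding B_def using K(1)
    by (intro compact_continuous_image continuous_intros compact_Int_closed closed_Collect_eq)
  moreover have "B \<subseteq> {s. vector [s, 0] \<in> V}"
    using K(2) by (auto simp: B_def vec)
  ultimately have "compact (B \<times> {0..t1})" "B \<times> {0..t1} \<subseteq> {s. vector [s, 0] \<in> V} \<times> {0..t1}"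
    by (auto intro: compact_Times)
  then obtain c where c: "0 < c" "\<And>z. z \<in> B \<times> {0..t1} \<Longrightarrow> \<bar>(\<lambda>(s, t). b (vector [s, 0]) t) z\<bar> \<le> c"
    using compact_continuous_bounded[OF _ continuous_on_subset[OF contb]] by metis
  have c': "\<bar>b q t\<bar> \<le> c" if "q \<in> K" "q $ 2 = 0" "t \<in> {0..t1}" for q t
    using c(2)[of "(q $ 1, t)"] that by (auto simp: B_def vec)
  define C where "C = c * exp F"
  have C: "0 < C" using c by (simp add: C_def)
  have \<kappa>p: "0 < \<kappa> p + 1"
    using pos[OF p] by (simp add: \<kappa>_def normal_scale_def add_nonneg_pos)
  define r where "r = min r0 (1 / (18 * C * (\<kappa> p + 1)))"
  have r: "0 < r" "r \<le> r0" "r \<le> 1 / (18 * C * (\<kappa> p + 1))"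
    using \<open>0 < r0\<close> C \<kappa>p by (auto simp: r_def)
  then have rC: "18 * r * C * (\<kappa> p + 1) \<le> 1"
  proof -
    have "0 < 18 * C * (\<kappa> p + 1)" using C \<kappa>p by simp
    then have "r * (18 * C * (\<kappa> p + 1)) \<le> 1"
      using r(3) by (simp only: pos_le_divide_eq)
    then show ?thesis by (simp only: mult_ac)
  qed
  have ball: "tilted_ball a p r \<subseteq> V" "tilted_ball a p r \<subseteq> K"
  proof -
    show "tilted_ball a p r \<subseteq> V" using ball0 r(1,2) less_imp_le by blast
    have "r\<^sup>2 \<le> r0\<^sup>2" using r by (intro power_mono) auto
    then show "tilted_ball a p r \<subseteq> K" by (auto simp: K_def tilted_ball_def)
  qed
  have "continuous_on V (\<lambda>q. second_order V G q (\<lambda>k. barrier_pd a p r k q) (barrier_pd2 a r))"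
    by (rule continuous_on_second_order[OF G_smooth G_pos])
      (auto intro: has_derivative_continuous_on has_derivative_at_withinI[OF barrier_pd_has_derivative])
  from continuous_on_subset[OF this K(2)]
  obtain K3 where K3: "0 < K3" "\<And>q. q \<in> K \<Longrightarrow> \<bar>second_order V G q (\<lambda>k. barrier_pd a p r k q) (barrier_pd2 a r)\<bar> \<le> K3"
    by (rule compact_continuous_bounded[OF K(1)]) (erule that, blast)
  define L where "L = 4 / 3 * exp (2 * F) * K3 + 2 * K2 + 1"
  show ?thesis
  proof (intro exI conjI allI impI)
    show "0 < r" "tilted_ball a p r \<subseteq> V" by (fact r(1), fact ball(1))
    fix L' M t :: real and q :: "real^2"
    assume L': "L \<le> L'" and M: "0 < M"
    show "\<not> touches gap t1 a p r L' M q t"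
    proof
      assume touch: "touches gap t1 a p r L' M q t"
      then have t: "t \<in> {0..t1}" and q: "q \<in> tilted_ball a p r" and q2: "0 \<le> q $ 2"
        by (auto simp: touches_def tilted_ball_def half_plane_def)
      have qK: "q \<in> K" "q \<in> V" using q ball by auto
      have Pq: "P q" using ball0 r(1,2) q less_imp_le by blast
      show False
      proof (cases "q $ 2 = 0")
        case True
        have "\<bar>b q t\<bar> * exp (f1 q t) \<le> C"
          unfolding C_def using c'[OF qK(1) True t] F1[OF qK(1) t] c(1) by (intro mult_mono) auto
        moreover have "18 * r * normal_scale q * C < G q $ 1 $ 1"
        proof -
          have "normal_scale q < (\<kappa> p + 1) * G q $ 1 $ 1"
            using Pq pos(1)[OF qK(2)] by (simp add: P_def \<kappa>_def field_simps)
          then have "18 * r * C * normal_scale q < 18 * r * C * ((\<kappa> p + 1) * G q $ 1 $ 1)"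
            using r C by simp
          also have "\<dots> = (18 * r * C * (\<kappa> p + 1)) * G q $ 1 $ 1"
            by (simp only: mult.assoc)
          also have "\<dots> \<le> 1 * G q $ 1 $ 1"
            using rC pos(1)[OF qK(2)] by (intro mult_right_mono) auto
          finally show ?thesis by (simp add: mult_ac)
        qed
        ultimately show False
          using touches_boundary_False[OF r(1) ball(1) M touch True] Pq True by (auto simp: P_def)
      next
        case False
        then have "0 < q $ 2" using q2 by simp
        moreover have "exp (- 2 * f1 q t) \<le> exp (2 * F)"
          using F1[OF qK(1) t] by simp
        moreover have "4 / 3 * exp (2 * F) * K3 + 2 * K2 < L'"
          using L' by (simp add: L_def)
        ultimately show False
          by (rule touches_interior_False[OF r(1) ball(1) M touch _ _ K2'[OF qK(1) t] K3(2)[OF qK(1)]])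
      qed
    qed
  qed
qed

end

section \<open>Globalisation\<close>

lemma chart_inverse:
  assumes "is_chart X c"
  shows "x \<in> fst c \<Longrightarrow> cinv c (snd c x) = x"
    and "q \<in> cimg c \<Longrightarrow> cinv c q \<in> fst c \<and> snd c (cinv c q) = q"
proof -
  have "openin X (fst c)" and hom: "homeomorphic_map (subtopology X (fst c)) (top_of_set (cimg c)) (snd c)"
    using assms by (auto simp: is_chart_def)
  then have "topspace (subtopology X (fst c)) = fst c"
    using openin_subset by fastforce
  then have inj: "inj_on (snd c) (fst c)"
    using homeomorphic_imp_injective_map[OF hom] by simp
  show "x \<in> fst c \<Longrightarrow> cinv c (snd c x) = x"
    using inj by (simp add: cinv_def)
  show "q \<in> cimg c \<Longrightarrow> cinv c q \<in> fst c \<and> snd c (cinv c q) = q"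
    by (simp add: cimg_def cinv_def inv_into_into f_inv_into_f)
qed

lemma openin_chart_preimage:
  assumes "is_chart X c" and "open U"
  shows "openin X {x \<in> fst c. snd c x \<in> U}"
proof -
  have o: "openin X (fst c)" and hom: "homeomorphic_map (subtopology X (fst c)) (top_of_set (cimg c)) (snd c)"
    using assms by (auto simp: is_chart_def)
  have top: "topspace (subtopology X (fst c)) = fst c"
    using openin_subset[OF o] by auto
  have "continuous_map (subtopology X (fst c)) (top_of_set (cimg c)) (snd c)"
    using hom by (rule homeomorphic_imp_continuous_map)
  then have "openin (subtopology X (fst c)) {x \<in> topspace (subtopology X (fst c)). snd c x \<in> cimg c \<inter> U}"
    by (rule openin_continuous_map_preimage) (use assms(2) in \<open>simp add: openin_open_Int\<close>)
  also have "{x \<in> topspace (subtopology X (fst c)). snd c x \<in> cimg c \<inter> U} = {x \<in> fst c. snd c x \<in> U}"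
    unfolding top by (auto simp: cimg_def)
  finally show ?thesis
    using o by (rule openin_trans_full)
qed

text \<open>Subtracting the two boundary conditions cancels the geodesic curvature, and
  \<open>\<psi>1 \<le> \<psi>2\<close> is multiplied by the positive \<open>exp u2\<close>. The
  other conditions are those of a classical solution, read through \<open>cinv c\<close> and
  restricted to \<open>{0..t1}\<close>.\<close>

lemma chart_solutions_classical:
  assumes surf: "compact_riemannian_surface X A g" and c: "c \<in> A"
    and \<psi>1: "admissible_data A \<alpha> T \<psi>1 u01"
    and u1: "classical_solution X A g \<alpha> T \<psi>1 u01 u1" and u2: "classical_solution X A g \<alpha> T \<psi>2 u02 u2"
    and le: "\<forall>x\<in>boundary A. \<forall>t\<in>time_span T. \<psi>1 x t \<le> \<psi>2 x t"
    and t1: "0 < t1" "ereal t1 < T"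
  shows "chart_solutions (cimg c) (g c) (\<lambda>q. u1 (cinv c q)) (\<lambda>q. u2 (cinv c q)) (\<lambda>q. \<psi>1 (cinv c q)) t1"
proof -
  have chart: "is_chart X c"
    using surf c by (auto simp: compact_riemannian_surface_def smooth_atlas_def)
  have span: "{0..t1} \<subseteq> time_span T"
  proof
    fix t assume "t \<in> {0..t1}"
    then have "0 \<le> t" "ereal t \<le> ereal t1" by auto
    then show "t \<in> time_span T"
      using le_less_trans[OF _ t1(2)] by (simp add: time_span_def)
  qed
  have holder: "holder_C2_1 A \<alpha> {0..t1} u1" "holder_C2_1 A \<alpha> {0..t1} u2"
    using u1 u2 t1 by (auto simp: classical_solution_def)
  note inv = chart_inverse(2)[OF chart]
  have pde: "((\<lambda>s. u (cinv c q) s) has_real_derivative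
      exp (- 2 * u (cinv c q) t) * laplacian (cimg c) (g c) (\<lambda>y. u (cinv c y) t) q - 1) (at t within {0..t1})"
    if "classical_solution X A g \<alpha> T \<psi> u0 u" "q \<in> cimg c" "t \<in> {0..t1}" for \<psi> u0 u q t
  proof -
    have "(u (cinv c q) has_real_derivative
      exp (- 2 * u (cinv c q) t) * laplacian (cimg c) (g c) (\<lambda>y. u (cinv c y) t) (snd c (cinv c q)) - 1) (at t within time_span T)"
      using that inv[of q] c span unfolding classical_solution_def by blast
    then show ?thesis
      using DERIV_subset[OF _ span] inv[OF that(2)] by simp
  qed
  have bdry: "normal_deriv (cimg c) (g c) (\<lambda>y. u (cinv c y) t) q + geodesic_curvature (cimg c) (g c) q
      = \<psi> (cinv c q) t * exp (u (cinv c q) t)"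
    if "classical_solution X A g \<alpha> T \<psi> u0 u" "q \<in> cimg c" "q $ 2 = 0" "t \<in> {0..t1}" for \<psi> u0 u q t
  proof -
    have "snd c (cinv c q) $ 2 = 0" "cinv c q \<in> fst c" "t \<in> time_span T"
      using inv[of q] that span by auto
    then have "normal_deriv (cimg c) (g c) (\<lambda>y. u (cinv c y) t) (snd c (cinv c q)) + geodesic_curvature (cimg c) (g c) (snd c (cinv c q))
      = \<psi> (cinv c q) t * exp (u (cinv c q) t)"
      using that(1) c unfolding classical_solution_def by blast
    then show ?thesis using inv[OF that(2)] by simp
  qed
  have reg: "(\<forall>t\<in>{0..t1}. (\<lambda>q. u (cinv c q) t) differentiable_on cimg c) \<and>
    (\<forall>t\<in>{0..t1}. \<forall>j. pd (cimg c) j (\<lambda>q. u (cinv c q) t) differentiable_on cimg c) \<and>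
    continuous_on (cimg c \<times> {0..t1}) (\<lambda>(q, t). u (cinv c q) t) \<and>
    continuous_on (cimg c \<times> {0..t1}) (\<lambda>(q, t). vector_derivative (u (cinv c q)) (at t within {0..t1}))"
    if "holder_C2_1 A \<alpha> {0..t1} u" for u
    using that[unfolded holder_C2_1_def Let_def, rule_format, OF c] by simp
  note reg1 = reg[OF holder(1)] and reg2 = reg[OF holder(2)]
  show ?thesis
  proof
    show "openin (top_of_set half_plane) (cimg c)"
      using chart by (simp add: is_chart_def)
    show "smooth_on (cimg c) (\<lambda>p. g c p $ i $ j)" for i j
      using surf c by (simp add: compact_riemannian_surface_def riemannian_metric_def)
    show "pos_def_sym (g c p)" if "p \<in> cimg c" for p
      using surf c that by (simp add: compact_riemannian_surface_def riemannian_metric_def pos_def_sym_def)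
    show "(\<lambda>q. u1 (cinv c q) t) differentiable_on cimg c" if "t \<in> {0..t1}" for t
      using reg1 that by blast
    show "(\<lambda>q. u2 (cinv c q) t) differentiable_on cimg c" if "t \<in> {0..t1}" for t
      using reg2 that by blast
    show "pd (cimg c) j (\<lambda>q. u1 (cinv c q) t) differentiable_on cimg c" if "t \<in> {0..t1}" for t j
      using reg1 that by blast
    show "pd (cimg c) j (\<lambda>q. u2 (cinv c q) t) differentiable_on cimg c" if "t \<in> {0..t1}" for t j
      using reg2 that by blast
    show "continuous_on (cimg c \<times> {0..t1}) (\<lambda>(q, t). u1 (cinv c q) t)"
      using reg1 by blast
    show "continuous_on (cimg c \<times> {0..t1}) (\<lambda>(q, t). u2 (cinv c q) t)"
      using reg2 by blast
    show "continuous_on (cimg c \<times> {0..t1})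
      (\<lambda>(q, t). exp (- 2 * u2 (cinv c q) t) * laplacian (cimg c) (g c) (\<lambda>y. u2 (cinv c y) t) q)"
    proof (rule continuous_on_eq)
      \<comment> \<open>The Hoelder class gives continuity of the time derivative. Adding 1 produces
        the required term by the equation, since derivatives within the nondegenerate interval
        \<open>{0..t1}\<close> are unique.\<close>
      show "continuous_on (cimg c \<times> {0..t1}) (\<lambda>z. (\<lambda>(q, t). vector_derivative (u2 (cinv c q)) (at t within {0..t1})) z + 1)"
        using reg2 by (intro continuous_on_add continuous_on_const) blast
    next
      fix z assume "z \<in> cimg c \<times> {0..t1}"
      then obtain q t where z: "z = (q, t)" "q \<in> cimg c" "t \<in> {0..t1}" by blast
      have "(u2 (cinv c q) has_vector_derivative
          exp (- 2 * u2 (cinv c q) t) * laplacian (cimg c) (g c) (\<lambda>y. u2 (cinv c y) t) q - 1) (at t within {0..t1})"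
        using pde[OF u2 z(2,3)] by (simp add: has_real_derivative_iff_has_vector_derivative)
      from vector_derivative_within_cbox[unfolded cbox_interval, OF t1(1) z(3) this]
      show "(\<lambda>(q, t). vector_derivative (u2 (cinv c q)) (at t within {0..t1})) z + 1
        = (\<lambda>(q, t). exp (- 2 * u2 (cinv c q) t) * laplacian (cimg c) (g c) (\<lambda>y. u2 (cinv c y) t) q) z"
        by (simp add: z(1))
    qed
    show "(u1 (cinv c q) has_real_derivative
        exp (- 2 * u1 (cinv c q) t) * laplacian (cimg c) (g c) (\<lambda>y. u1 (cinv c y) t) q - 1) (at t within {0..t1})"
      if "q \<in> cimg c" "t \<in> {0..t1}" for q t
      by (rule pde[OF u1 that])
    show "(u2 (cinv c q) has_real_derivative
        exp (- 2 * u2 (cinv c q) t) * laplacian (cimg c) (g c) (\<lambda>y. u2 (cinv c y) t) q - 1) (at t within {0..t1})"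
      if "q \<in> cimg c" "t \<in> {0..t1}" for q t
      by (rule pde[OF u2 that])
    show "normal_deriv (cimg c) (g c) (\<lambda>y. u1 (cinv c y) t) q - normal_deriv (cimg c) (g c) (\<lambda>y. u2 (cinv c y) t) q
        \<le> \<psi>1 (cinv c q) t * (exp (u1 (cinv c q) t) - exp (u2 (cinv c q) t))"
      if "q \<in> cimg c" "q $ 2 = 0" "t \<in> {0..t1}" for q t
    proof -
      have "cinv c q \<in> boundary A" "t \<in> time_span T"
        using inv[OF that(1)] that c span by (auto simp: boundary_def)
      then have "\<psi>1 (cinv c q) t * exp (u2 (cinv c q) t) \<le> \<psi>2 (cinv c q) t * exp (u2 (cinv c q) t)"
        using le by simp
      then show ?thesis
        using bdry[OF u1 that] bdry[OF u2 that] unfolding right_diff_distrib by linarith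
    qed
    have "holder_boundary A \<alpha> {0..t1} \<psi>1"
      using \<psi>1 t1 by (simp add: admissible_data_def)
    from this[unfolded holder_boundary_def Let_def, rule_format, OF c]
    show "continuous_on ({s. vector [s, 0] \<in> cimg c} \<times> {0..t1}) (\<lambda>(s, t). \<psi>1 (cinv c (vector [s, 0])) t)"
      by blast
  qed
qed

section \<open>Comparison over a finite family of barriers\<close>

definition local_barrier_at :: "('a \<Rightarrow> real \<Rightarrow> real) \<Rightarrow> real \<Rightarrow> 'a chart \<Rightarrow> real \<Rightarrow> real^2 \<Rightarrow> real \<Rightarrow> real \<Rightarrow> bool" where
  "local_barrier_at w t1 c a p r L \<longleftrightarrow>
     p \<in> half_plane \<and> 0 < r \<and> tilted_ball a p r \<subseteq> cimg c \<and>
     continuous_on (cimg c \<times> {0..t1}) (\<lambda>(q, t). w (cinv c q) t) \<and>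
     (\<forall>L' M q t. L \<le> L' \<longrightarrow> 0 < M \<longrightarrow> \<not> touches (\<lambda>q. w (cinv c q)) t1 a p r L' M q t)"

text \<open>Half the radius brings the barrier down to at most 11/8; the strict inequality makes the
  set open in the surface.\<close>

definition half_ball :: "'a chart \<Rightarrow> real \<Rightarrow> real^2 \<Rightarrow> real \<Rightarrow> 'a set" where
  "half_ball c a p r = {y \<in> fst c. tilt a (snd c y - p) < (r / 2)\<^sup>2}"

text \<open>The minimum of the barriers is never formed: maximising \<open>w\<close> divided by the
  weighted barrier over all members of the family and all points of their compact cylinders has the
  same effect. A positive maximum is attained off the rim and after time 0, so it is a touching
  point, which \<open>local_barrier_at\<close> forbids.\<close>

lemma barrier_comparison:
  fixes w :: "'a \<Rightarrow> real \<Rightarrow> real"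
  assumes X: "compact_space X" "\<And>c. c \<in> A \<Longrightarrow> is_chart X c"
    and t1: "0 < t1"
    and loc: "\<And>x. x \<in> topspace X \<Longrightarrow>
      \<exists>c\<in>A. \<exists>a p r L. x \<in> half_ball c a p r \<and> local_barrier_at w t1 c a p r L"
    and init: "\<And>x. x \<in> topspace X \<Longrightarrow> w x 0 \<le> 0"
    and x: "x \<in> topspace X"
  shows "w x t1 \<le> 0"
proof (rule ccontr)
  assume "\<not> w x t1 \<le> 0"
  then have wx: "0 < w x t1" by simp
  define J where "J = {(c, a, p, r, L). c \<in> A \<and> local_barrier_at w t1 c a p r L}"
  define N where "N = (\<lambda>(c :: 'a chart, a, p, r, L :: real). half_ball c a p r)"
  have "openin X (N i)" if i: "i \<in> J" for i
  proof -
    obtain c a p r L where i': "i = (c, a, p, r, L)" by (cases i)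
    have "open {q. tilt a (q - p) < (r / 2)\<^sup>2}"
      by (intro open_Collect_less continuous_on_tilt continuous_intros)
    from openin_chart_preimage[OF X(2) this, of c] show ?thesis
      using i by (simp add: i' J_def N_def half_ball_def)
  qed
  moreover have "topspace X \<subseteq> \<Union> (N ` J)"
  proof
    fix y assume "y \<in> topspace X"
    from loc[OF this] obtain c a p r L where
      "c \<in> A" "y \<in> half_ball c a p r" "local_barrier_at w t1 c a p r L" by blast
    then have "(c, a, p, r, L) \<in> J" "y \<in> N (c, a, p, r, L)"
      by (simp_all add: J_def N_def)
    then show "y \<in> \<Union> (N ` J)" by blast
  qed
  ultimately obtain \<F> where "finite \<F>" "\<F> \<subseteq> N ` J" "topspace X \<subseteq> \<Union>\<F>"
    using X(1) unfolding compact_space_alt by (metis (no_types, lifting) imageE)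
  then obtain S where S: "S \<subseteq> J" "finite S" "\<F> = N ` S"
    using finite_subset_image by metis
  have cover: "topspace X \<subseteq> \<Union> (N ` S)"
    using \<open>topspace X \<subseteq> \<Union>\<F>\<close> S(3) by simp
  have "S \<noteq> {}" using cover x by blast
  define rate where "rate = (\<lambda>(c :: 'a chart, a :: real, p :: real^2, r :: real, L :: real). L)"
  \<comment> \<open>A common rate makes the weights of different members comparable at the same
    time; the largest one is admissible because each member forbids touching at every rate above its
    own.\<close>
  define \<Lambda> where "\<Lambda> = Max (rate ` S)"
  have rate: "rate i \<le> \<Lambda>" if "i \<in> S" for i
    unfolding \<Lambda>_def using S(2) that by simp
  define ball where "ball = (\<lambda>(c :: 'a chart, a, p, r, L :: real). tilted_ball a p r)"
  define ratio where "ratio = (\<lambda>(c :: 'a chart, a, p, r, L :: real) (q, s). w (cinv c q) s / (exp (\<Lambda> * s) * barrier a p r q))"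
  have "\<exists>z\<in>ball i \<times> {0..t1}. \<forall>z'\<in>ball i \<times> {0..t1}. ratio i z' \<le> ratio i z" if iS: "i \<in> S" for i
  proof -
    obtain c a p r L where i': "i = (c, a, p, r, L)" by (cases i)
    have i: "p \<in> half_plane" "0 < r" "tilted_ball a p r \<subseteq> cimg c"
      "continuous_on (cimg c \<times> {0..t1}) (\<lambda>(q, t). w (cinv c q) t)"
      using iS S(1) by (auto simp: i' J_def local_barrier_at_def)
    have "continuous_on (tilted_ball a p r \<times> {0..t1}) (\<lambda>z. (\<lambda>(q, t). w (cinv c q) t) z / (exp (\<Lambda> * snd z) * barrier a p r (fst z)))"
    proof (intro continuous_intros)
      show "continuous_on (tilted_ball a p r \<times> {0..t1}) (\<lambda>(q, t). w (cinv c q) t)"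
        by (rule continuous_on_subset[OF i(4)]) (use i(3) in auto)
      have "continuous_on UNIV (barrier a p r)"
        using has_derivative_continuous[OF barrier_has_derivative] by (simp add: continuous_on_eq_continuous_at)
      then show "continuous_on (tilted_ball a p r \<times> {0..t1}) (\<lambda>z. barrier a p r (fst z))"
        by (rule continuous_on_compose2) (auto intro: continuous_intros)
      show "\<forall>z\<in>tilted_ball a p r \<times> {0..t1}. exp (\<Lambda> * snd z) * barrier a p r (fst z) \<noteq> 0"
        using barrier_bounds(1)[OF i(2)] by (force simp: tilted_ball_def)
    qed
    then have "continuous_on (ball i \<times> {0..t1}) (ratio i)"
      by (simp add: i' ball_def ratio_def case_prod_unfold)
    moreover have "compact (ball i \<times> {0..t1})"
      using i(2) by (auto simp: i' ball_def intro!: compact_Times compact_tilted_ball)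
    moreover have "p \<in> tilted_ball a p r"
      using i by (simp add: tilted_ball_def tilt_def)
    then have "(p, 0) \<in> ball i \<times> {0..t1}"
      using t1 by (simp add: i' ball_def)
    then have "ball i \<times> {0..t1} \<noteq> {}" by blast
    ultimately show ?thesis
      using continuous_attains_sup by blast
  qed
  then obtain \<zeta> where \<zeta>: "\<And>i. i \<in> S \<Longrightarrow> \<zeta> i \<in> ball i \<times> {0..t1}"
    "\<And>i z. i \<in> S \<Longrightarrow> z \<in> ball i \<times> {0..t1} \<Longrightarrow> ratio i z \<le> ratio i (\<zeta> i)"
    by metis
  define M where "M = Max ((\<lambda>i. ratio i (\<zeta> i)) ` S)"
  have "M \<in> (\<lambda>i. ratio i (\<zeta> i)) ` S"
    unfolding M_def using S(2) \<open>S \<noteq> {}\<close> by (intro Max_in) auto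
  then obtain k where k: "k \<in> S" "M = ratio k (\<zeta> k)" by blast
  have Mmax: "ratio i z \<le> M" if "i \<in> S" "z \<in> ball i \<times> {0..t1}" for i z
  proof -
    have "ratio i (\<zeta> i) \<le> M" unfolding M_def using S(2) that(1) by simp
    then show ?thesis using \<zeta>(2)[OF that] by linarith
  qed
  have below: "w (cinv c q) s \<le> M * exp (\<Lambda> * s) * barrier a p r q"
    if "(c, a, p, r, L) \<in> S" "q \<in> tilted_ball a p r" "s \<in> {0..t1}" for c a p r L q s
  proof -
    have "0 < r" using that(1) S(1) by (auto simp: J_def local_barrier_at_def)
    then have "0 < barrier a p r q"
      using barrier_bounds(1)[of r a q p] that(2) by (simp add: tilted_ball_def)
    moreover have "w (cinv c q) s / (exp (\<Lambda> * s) * barrier a p r q) \<le> M"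
      using Mmax[OF that(1), of "(q, s)"] that(2,3) by (simp add: ratio_def ball_def)
    ultimately show ?thesis
      by (simp add: pos_divide_le_eq mult.assoc)
  qed
  \<comment> \<open>Every point lies in some half ball of the finite cover. Positivity of that
    barrier gives \<open>0 < M\<close>, and its bound 11/8 excludes the rim.\<close>
  have near: "\<exists>c a p r L. (c, a, p, r, L) \<in> S \<and> cinv c (snd c y) = y \<and> snd c y \<in> tilted_ball a p r \<and>
      0 < barrier a p r (snd c y) \<and> barrier a p r (snd c y) \<le> 11 / 8" if y: "y \<in> topspace X" for y
  proof -
    obtain i where "i \<in> S" "y \<in> N i" using cover y by blast
    moreover obtain c a p r L where "i = (c, a, p, r, L)" by (cases i)
    ultimately have i: "(c, a, p, r, L) \<in> S" "y \<in> fst c" "tilt a (snd c y - p) < (r / 2)\<^sup>2"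
      by (simp_all add: N_def half_ball_def)
    then have J: "c \<in> A" "0 < r" using S(1) by (auto simp: J_def local_barrier_at_def)
    have "snd c y \<in> cimg c" using i(2) by (simp add: cimg_def)
    then have "snd c y \<in> half_plane"
      using X(2)[OF J(1)] openin_imp_subset by (auto simp: is_chart_def)
    moreover have tilt: "tilt a (snd c y - p) \<le> r\<^sup>2"
    proof -
      have "(r / 2)\<^sup>2 \<le> r\<^sup>2" using J(2) by (intro power_mono) auto
      then show ?thesis using i(3) by linarith
    qed
    ultimately have "snd c y \<in> tilted_ball a p r" by (simp add: tilted_ball_def)
    moreover have "0 < barrier a p r (snd c y)" "barrier a p r (snd c y) \<le> 11 / 8"
      using barrier_bounds(1,4)[OF J(2) tilt] i(3) by linarith+
    ultimately show ?thesis
      using i(1) chart_inverse(1)[OF X(2)[OF J(1)] i(2)] by blast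
  qed
  have "0 < M"
  proof (rule ccontr)
    assume "\<not> 0 < M"
    obtain c a p r L where c: "(c, a, p, r, L) \<in> S" "cinv c (snd c x) = x"
      "snd c x \<in> tilted_ball a p r" "0 < barrier a p r (snd c x)"
      using near[OF x] by blast
    have "w x t1 \<le> M * (exp (\<Lambda> * t1) * barrier a p r (snd c x))"
      using below[OF c(1,3), of t1] c(2) t1 by (simp add: mult.assoc)
    also have "\<dots> \<le> 0"
      using \<open>\<not> 0 < M\<close> c(4) by (intro mult_nonpos_nonneg) auto
    finally show False using wx by simp
  qed
  obtain c a p r L where k': "k = (c, a, p, r, L)" by (cases k)
  obtain q s where z: "\<zeta> k = (q, s)" by (cases "\<zeta> k")
  have qs: "q \<in> tilted_ball a p r" "s \<in> {0..t1}"
    using \<zeta>(1)[OF k(1)] unfolding z by (simp_all add: k' ball_def)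
  have cA: "c \<in> A" and loc_k: "local_barrier_at w t1 c a p r L"
    using k S(1) by (auto simp: k' J_def)
  then have r: "0 < r" "q \<in> cimg c" using qs(1) by (auto simp: local_barrier_at_def)
  have B: "3 / 4 \<le> barrier a p r q"
    using barrier_bounds(1)[OF r(1)] qs(1) by (simp add: tilted_ball_def)
  have eq: "w (cinv c q) s = M * exp (\<Lambda> * s) * barrier a p r q"
  proof -
    have "M = w (cinv c q) s / (exp (\<Lambda> * s) * barrier a p r q)"
      using k(2) unfolding z by (simp add: k' ratio_def)
    then show ?thesis using B by (simp add: mult.assoc)
  qed
  then have pos: "0 < w (cinv c q) s"
    using \<open>0 < M\<close> B by simp
  have y: "cinv c q \<in> topspace X"
    using chart_inverse(2)[OF X(2)[OF cA] r(2)] X(2)[OF cA] openin_subset by (auto simp: is_chart_def)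
  have "s \<noteq> 0" using pos init[OF y] by auto
  \<comment> \<open>On the rim this barrier is at least 7/4, while another member is at most 11/8 at
    the same point of the surface; \<open>below\<close> for that member would put \<open>w\<close>
    strictly under its own value. The two charts are linked only through this value of
    \<open>w\<close>.\<close>
  have "tilt a (q - p) \<noteq> r\<^sup>2"
  proof
    assume "tilt a (q - p) = r\<^sup>2"
    then have large: "7 / 4 \<le> barrier a p r q"
      using barrier_bounds(3)[OF r(1)] by simp
    obtain c' a' p' r' L' where c': "(c', a', p', r', L') \<in> S" "cinv c' (snd c' (cinv c q)) = cinv c q"
      "snd c' (cinv c q) \<in> tilted_ball a' p' r'" "barrier a' p' r' (snd c' (cinv c q)) \<le> 11 / 8"
      using near[OF y] by blast
    have E: "0 < M * exp (\<Lambda> * s)" using \<open>0 < M\<close> by simp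
    have "w (cinv c q) s \<le> M * exp (\<Lambda> * s) * barrier a' p' r' (snd c' (cinv c q))"
      using below[OF c'(1,3) qs(2)] c'(2) by simp
    also have "\<dots> < M * exp (\<Lambda> * s) * barrier a p r q"
      using c'(4) large by (intro mult_strict_left_mono[OF _ E]) linarith
    finally show False using eq by simp
  qed
  then have "touches (\<lambda>q. w (cinv c q)) t1 a p r \<Lambda> M q s"
    using qs \<open>s \<noteq> 0\<close> eq below[OF k(1)[unfolded k']] unfolding touches_def
    by (auto simp: tilted_ball_def)
  moreover have "L \<le> \<Lambda>" using rate[OF k(1)] by (simp add: rate_def k')
  ultimately show False
    using loc_k \<open>0 < M\<close> unfolding local_barrier_at_def by blast
qed

theorem theorem3p1:
  fixes X :: "'a topology"
    and A :: "'a chart set"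
    and g :: "'a chart \<Rightarrow> real^2 \<Rightarrow> real^2^2"
    and \<alpha> :: real and T :: ereal
    and \<psi>1 \<psi>2 u1 u2 :: "'a \<Rightarrow> real \<Rightarrow> real"
    and u01 u02 :: "'a \<Rightarrow> real"
  assumes "compact_riemannian_surface X A g"
    and "\<forall>c\<in>A. \<forall>p\<in>cimg c. gauss_curvature (cimg c) (g c) p = 0"
    and "0 < \<alpha>" and "\<alpha> < 1" and "0 < T"
    and "admissible_data A \<alpha> T \<psi>1 u01" and "admissible_data A \<alpha> T \<psi>2 u02"
    and "classical_solution X A g \<alpha> T \<psi>1 u01 u1"
    and "classical_solution X A g \<alpha> T \<psi>2 u02 u2"
    and "\<forall>x\<in>topspace X. u01 x \<le> u02 x"
    and "\<forall>x\<in>boundary A. \<forall>t\<in>time_span T. \<psi>1 x t \<le> \<psi>2 x t"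
  shows "\<forall>x\<in>topspace X. \<forall>t\<in>time_span T. u1 x t \<le> u2 x t"
proof (intro ballI)
  fix x t1 assume x: "x \<in> topspace X" and t1: "t1 \<in> time_span T"
  have atlas: "compact_space X" "\<And>c. c \<in> A \<Longrightarrow> is_chart X c" "(\<Union>c\<in>A. fst c) = topspace X"
    using assms(1) by (auto simp: compact_riemannian_surface_def smooth_atlas_def)
  have init: "u1 y 0 - u2 y 0 \<le> 0" if "y \<in> topspace X" for y
    using assms(8,9,10) that by (simp add: classical_solution_def)
  show "u1 x t1 \<le> u2 x t1"
  \<comment> \<open>Each \<open>t1\<close> is the final time of its own interval, so a comparison at
    the last instant suffices; that comparison needs positive length, hence the separate case
    0.\<close>
  proof (cases "t1 = 0")
    case True
    then show ?thesis using init[OF x] by simp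
  next
    case False
    then have t1': "0 < t1" "ereal t1 < T" using t1 by (auto simp: time_span_def)
    have "u1 x t1 - u2 x t1 \<le> 0"
    proof (rule barrier_comparison[where w = "\<lambda>y t. u1 y t - u2 y t", OF atlas(1,2) t1'(1) _ init x])
      fix y assume "y \<in> topspace X"
      then obtain c where c: "c \<in> A" "y \<in> fst c" using atlas(3) by blast
      interpret chart_solutions "cimg c" "g c" "\<lambda>q. u1 (cinv c q)" "\<lambda>q. u2 (cinv c q)" "\<lambda>q. \<psi>1 (cinv c q)" t1
        by (rule chart_solutions_classical[OF assms(1) c(1) assms(6,8,9,11) t1'])
      have p: "snd c y \<in> cimg c" using c(2) by (simp add: cimg_def)
      obtain a r L where a: "0 < r" "tilted_ball a (snd c y) r \<subseteq> cimg c"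
        and no_touch: "\<forall>L' M q t. L \<le> L' \<longrightarrow> 0 < M \<longrightarrow> \<not> touches gap t1 a (snd c y) r L' M q t"
        using local_barrier[OF p] by blast
      have "continuous_on (cimg c \<times> {0..t1}) (\<lambda>z. (\<lambda>(q, t). u1 (cinv c q) t) z - (\<lambda>(q, t). u2 (cinv c q) t) z)"
        by (intro continuous_on_diff cont1 cont2)
      then have "local_barrier_at (\<lambda>y t. u1 y t - u2 y t) t1 c a (snd c y) r L"
        unfolding local_barrier_at_def case_prod_unfold
        by (intro conjI no_touch a) (use p openin_imp_subset[OF V] in auto)
      moreover have "y \<in> half_ball c a (snd c y) r"
        using c(2) a(1) by (simp add: half_ball_def tilt_def)
      ultimately show "\<exists>c\<in>A. \<exists>a p r L. y \<in> half_ball c a p r \<and> local_barrier_at (\<lambda>y t. u1 y t - u2 y t) t1 c a p r L"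
        using c(1) by blast
    qed
    then show ?thesis by simp
  qed
qed

end
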